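(* Let $p$ be an odd prime and let $(\alpha,\beta)\in\mathbb{Q}_p^2$ have a $p$-adic MCF expansion of length $\geq n+1$. Let $t,u\in\mathbb{Z}[1/p]$ and $v\in\mathbb{Z}$, $v\neq0$, and assume \[\max\left\{\left|\alpha-\frac tv\right|_p,\left|\beta-\frac uv\right|_p\right\}<\frac{1}{p^{2K_{n+1}}}.\] Then $\max\{|t|_\infty,|u|_\infty,|v|_\infty\}\geq\frac{1}{3\tilde x^n}$.
   Context: $|\cdot|_\infty$ is the real absolute value, $\nu_p$ the $p$-adic valuation, $|x|_p=p^{-\nu_p(x)}$. $\tilde x$ denotes the unique positive real root of $X^3-\frac12X^2-\frac1{2p}X-\frac1{p^3}$. Browkin's $s$-function $s:\mathbb{Q}_p\to\mathbb{Z}[1/p]\cap(-p/2,p/2)$ is $s(\alpha)=\sum_{j=k}^{0}x_jp^j$ where $\alpha=\sum_{j=k}^\infty x_jp^j$, $x_j\in\mathbb{Z}\cap(-p/2,p/2)$ (empty sum $=0$ if $k>0$). The $p$-adic Jacobi–Perron algorithm applied to $(\alpha,\beta)$: $\alpha_0=\alpha,\beta_0=\beta$, and for $k\geq0$: $a_k=s(\alpha_k)$, $b_k=s(\beta_k)$, and if $\beta_k\neq b_k$, $\alpha_{k+1}=1/(\beta_k-b_k)$, $\beta_{k+1}=(\alpha_k-a_k)/(\beta_k-b_k)$; if $\beta_k=b_k$ it stops. The expansion has length $\geq N$ if $a_N,b_N$ are defined. For $n\geq1$, $k_n=\nu_p(1/a_n)$ and $K_n=k_1+\cdots+k_n$.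 *)

theory Defs
  imports "HOL-Analysis.Analysis" "Berlekamp_Zassenhaus.Finite_Field"
begin

section \<open>The p-adic absolute value on the rationals\<close>

text \<open>The valuation of 0 is 0 here by convention; \<open>rat_padic_abs\<close> treats 0 separately.\<close>

definition rat_padic_val :: "nat \<Rightarrow> rat \<Rightarrow> int" where
  "rat_padic_val p x =
     int (multiplicity (int p) (fst (quotient_of x))) -
     int (multiplicity (int p) (snd (quotient_of x)))"

definition rat_padic_abs :: "nat \<Rightarrow> rat \<Rightarrow> real" where
  "rat_padic_abs p x = (if x = 0 then 0 else real p powi (- rat_padic_val p x))"

definition padic_cauchy :: "nat \<Rightarrow> (nat \<Rightarrow> rat) \<Rightarrow> bool" where
  "padic_cauchy p X \<longleftrightarrow>
     (\<forall>e>0. \<exists>N. \<forall>m\<ge>N. \<forall>n\<ge>N. rat_padic_abs p (X m - X n) < e)"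

definition padic_null :: "nat \<Rightarrow> (nat \<Rightarrow> rat) \<Rightarrow> bool" where
  "padic_null p X \<longleftrightarrow> (\<lambda>n. rat_padic_abs p (X n)) \<longlonglongrightarrow> 0"

definition padic_rel :: "nat \<Rightarrow> (nat \<Rightarrow> rat) \<Rightarrow> (nat \<Rightarrow> rat) \<Rightarrow> bool" where
  "padic_rel p X Y \<longleftrightarrow>
     padic_cauchy p X \<and> padic_cauchy p Y \<and> padic_null p (\<lambda>n. X n - Y n)"

context
  fixes p :: nat
  assumes p: "prime p"
begin

lemma rat_padic_val_frac:
  assumes "a \<noteq> 0" "b \<noteq> 0"
  shows "rat_padic_val p (of_int a / of_int b) =
    int (multiplicity (int p) a) - int (multiplicity (int p) b)"
proof -
  have pe: "prime_elem (int p)" using p by simp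
  obtain c d where q: "quotient_of (of_int a / of_int b) = (c, d)" by (metis surj_pair)
  have d: "d > 0" using q quotient_of_denom_pos by blast
  have eq: "(of_int a / of_int b :: rat) = of_int c / of_int d" using q quotient_of_div by blast
  have c: "c \<noteq> 0" using eq assms d by auto
  have "(of_int (a * d) :: rat) = of_int (c * b)"
    using eq assms d by (simp add: field_simps)
  then have "a * d = c * b" by (simp only: of_int_eq_iff)
  then have "multiplicity (int p) a + multiplicity (int p) d =
      multiplicity (int p) c + multiplicity (int p) b"
    using prime_elem_multiplicity_mult_distrib[OF pe] assms c d
    by (metis less_irrefl)
  then show ?thesis by (simp add: rat_padic_val_def q)
qed

lemma rat_frac_cases:
  fixes x :: rat
  obtains a b where "x = of_int a / of_int b" "b \<noteq> 0"
  by (metis quotient_of_div quotient_of_denom_pos surj_pair less_irrefl)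

lemma rat_padic_abs_nonneg: "rat_padic_abs p x \<ge> 0"
  by (simp add: rat_padic_abs_def)

lemma rat_padic_abs_zero: "rat_padic_abs p 0 = 0"
  by (simp add: rat_padic_abs_def)

lemma rat_padic_abs_eq_0_iff: "rat_padic_abs p x = 0 \<longleftrightarrow> x = 0"
  using p prime_gt_0_nat by (auto simp: rat_padic_abs_def power_int_eq_0_iff)

lemma rat_padic_abs_one: "rat_padic_abs p 1 = 1"
  by (simp add: rat_padic_abs_def rat_padic_val_def)

lemma rat_padic_abs_mult: "rat_padic_abs p (x * y) = rat_padic_abs p x * rat_padic_abs p y"
proof (cases "x = 0 \<or> y = 0")
  case False
  have pe: "prime_elem (int p)" using p by simp
  obtain a b where x: "x = of_int a / of_int b" "b \<noteq> 0" by (rule rat_frac_cases)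
  obtain c d where y: "y = of_int c / of_int d" "d \<noteq> 0" by (rule rat_frac_cases)
  have ac: "a \<noteq> 0" "c \<noteq> 0" using x y False by auto
  have xy: "x * y = of_int (a * c) / of_int (b * d)" using x y by simp
  have "rat_padic_val p (x * y) = rat_padic_val p x + rat_padic_val p y"
    unfolding xy using x y ac
    by (simp add: rat_padic_val_frac prime_elem_multiplicity_mult_distrib[OF pe] del: of_int_mult)
  then show ?thesis using False p prime_gt_0_nat[OF p]
    by (simp add: rat_padic_abs_def power_int_add[symmetric])
qed (auto simp: rat_padic_abs_def)

lemma rat_padic_abs_minus: "rat_padic_abs p (- x) = rat_padic_abs p x"
proof -
  have "rat_padic_abs p (- 1) * rat_padic_abs p (- 1) = 1"
    using rat_padic_abs_mult[of "- 1" "- 1"] by (simp add: rat_padic_abs_one)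
  then have "rat_padic_abs p (- 1) = 1"
    using rat_padic_abs_nonneg[of "- 1"] by (auto simp: square_eq_1_iff)
  then show ?thesis using rat_padic_abs_mult[of "- 1" x] by simp
qed

lemma rat_padic_abs_diff_commute: "rat_padic_abs p (x - y) = rat_padic_abs p (y - x)"
  using rat_padic_abs_minus[of "x - y"] by simp

lemma rat_padic_abs_inverse: "rat_padic_abs p (inverse x) = inverse (rat_padic_abs p x)"
proof (cases "x = 0")
  case False
  then have "rat_padic_abs p x * rat_padic_abs p (inverse x) = 1"
    using rat_padic_abs_mult[of x "inverse x"] by (simp add: rat_padic_abs_one)
  then show ?thesis by (metis inverse_unique)
qed (auto simp: rat_padic_abs_def)

lemma rat_padic_abs_add:
  "rat_padic_abs p (x + y) \<le> max (rat_padic_abs p x) (rat_padic_abs p y)"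
proof (cases "x = 0 \<or> y = 0 \<or> x + y = 0")
  case True
  then show ?thesis
    using rat_padic_abs_nonneg[of x] by (auto simp: rat_padic_abs_zero le_max_iff_disj)
next
  case False
  have pe: "prime_elem (int p)" using p by simp
  obtain a b where x: "x = of_int a / of_int b" "b \<noteq> 0" by (rule rat_frac_cases)
  obtain c d where y: "y = of_int c / of_int d" "d \<noteq> 0" by (rule rat_frac_cases)
  have x': "x = of_int (a * d) / of_int (b * d)" and y': "y = of_int (c * b) / of_int (b * d)"
    using x y by simp_all
  have xy': "x + y = of_int (a * d + c * b) / of_int (b * d)"
    unfolding x' y' by (simp add: add_divide_distrib)
  have "a * d + c * b \<noteq> 0"
  proof
    assume "a * d + c * b = 0"
    then have "x + y = 0" unfolding xy' by (simp only: of_int_0 div_0)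
    then show False using False by simp
  qed
  then have nz: "a * d \<noteq> 0" "c * b \<noteq> 0" "a * d + c * b \<noteq> 0" "b * d \<noteq> 0"
    using False x y by auto
  let ?m = "multiplicity (int p)"
  have np: "\<not> is_unit (int p)" using p not_prime_unit[of "int p"] by auto
  have "int p ^ min (?m (a * d)) (?m (c * b)) dvd a * d + c * b"
    by (intro dvd_add multiplicity_dvd') auto
  then have "min (?m (a * d)) (?m (c * b)) \<le> ?m (a * d + c * b)"
    using power_dvd_iff_le_multiplicity nz np by blast
  then have "min (rat_padic_val p x) (rat_padic_val p y) \<le> rat_padic_val p (x + y)"
    unfolding xy' unfolding x' y' rat_padic_val_frac[OF nz(1,4)] rat_padic_val_frac[OF nz(2,4)]
      rat_padic_val_frac[OF nz(3,4)] by linarith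
  then have "rat_padic_val p x \<le> rat_padic_val p (x + y) \<or>
      rat_padic_val p y \<le> rat_padic_val p (x + y)"
    by linarith
  moreover have "real p \<ge> 1" using p prime_ge_1_nat by auto
  ultimately show ?thesis using False
    by (auto simp: rat_padic_abs_def le_max_iff_disj intro!: power_int_increasing)
qed

lemma rat_padic_abs_triangle:
  "rat_padic_abs p (x + y) \<le> rat_padic_abs p x + rat_padic_abs p y"
  using rat_padic_abs_add[of x y] rat_padic_abs_nonneg[of x] rat_padic_abs_nonneg[of y] by linarith

lemma rat_padic_abs_abs_diff:
  "\<bar>rat_padic_abs p x - rat_padic_abs p y\<bar> \<le> rat_padic_abs p (x - y)"
  using rat_padic_abs_triangle[of "x - y" y] rat_padic_abs_triangle[of "y - x" x]
    rat_padic_abs_diff_commute[of x y] by (simp add: abs_le_iff)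

lemma padic_null_squeeze:
  assumes "f \<longlonglongrightarrow> 0" "eventually (\<lambda>n. rat_padic_abs p (X n) \<le> f n) sequentially"
  shows "padic_null p X"
  unfolding padic_null_def
  by (rule tendsto_sandwich[OF _ assms(2) tendsto_const assms(1)])
     (simp add: rat_padic_abs_nonneg)

lemma padic_null_zero: "padic_null p (\<lambda>n. 0)"
  by (simp add: padic_null_def rat_padic_abs_zero)

lemma padic_null_add:
  assumes "padic_null p X" "padic_null p Y"
  shows "padic_null p (\<lambda>n. X n + Y n)"
  by (rule padic_null_squeeze[OF tendsto_add_zero[OF assms[unfolded padic_null_def]]])
     (simp add: rat_padic_abs_triangle)

lemma padic_null_minus: "padic_null p X \<Longrightarrow> padic_null p (\<lambda>n. - X n)"
  by (simp add: padic_null_def rat_padic_abs_minus)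

lemma padic_null_diff:
  "padic_null p X \<Longrightarrow> padic_null p Y \<Longrightarrow> padic_null p (\<lambda>n. X n - Y n)"
  using padic_null_add[OF _ padic_null_minus, of X Y] by simp

lemma padic_null_diff_commute:
  "padic_null p (\<lambda>n. X n - Y n) \<Longrightarrow> padic_null p (\<lambda>n. Y n - X n)"
  using padic_null_minus[of "\<lambda>n. X n - Y n"] by simp

lemma padic_cauchy_const: "padic_cauchy p (\<lambda>n. c)"
  by (simp add: padic_cauchy_def rat_padic_abs_zero)

lemma padic_cauchy_real:
  assumes "padic_cauchy p X"
  shows "Cauchy (\<lambda>n. rat_padic_abs p (X n))"
proof (rule metric_CauchyI)
  fix e :: real assume "e > 0"
  then obtain N where "\<forall>m\<ge>N. \<forall>n\<ge>N. rat_padic_abs p (X m - X n) < e"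
    using assms by (auto simp: padic_cauchy_def)
  then show "\<exists>M. \<forall>m\<ge>M. \<forall>n\<ge>M. dist (rat_padic_abs p (X m)) (rat_padic_abs p (X n)) < e"
    unfolding dist_real_def using rat_padic_abs_abs_diff le_less_trans by blast
qed

lemma padic_cauchy_tendsto:
  assumes "padic_cauchy p X"
  shows "(\<lambda>n. rat_padic_abs p (X n)) \<longlonglongrightarrow> lim (\<lambda>n. rat_padic_abs p (X n))"
  using padic_cauchy_real[OF assms] Cauchy_convergent_iff convergent_LIMSEQ_iff by blast

lemma padic_cauchy_bounded:
  assumes "padic_cauchy p X"
  obtains B where "B > 0" "\<And>n. rat_padic_abs p (X n) \<le> B"
proof -
  have "Bseq (\<lambda>n. rat_padic_abs p (X n))"
    using padic_cauchy_real[OF assms] by (simp add: Cauchy_Bseq)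
  then show ?thesis using that rat_padic_abs_nonneg by (auto simp: Bseq_def)
qed

lemma padic_cauchy_add:
  assumes "padic_cauchy p X" "padic_cauchy p Y"
  shows "padic_cauchy p (\<lambda>n. X n + Y n)"
  unfolding padic_cauchy_def
proof (intro allI impI)
  fix e :: real assume e: "e > 0"
  obtain M where M: "\<forall>m\<ge>M. \<forall>n\<ge>M. rat_padic_abs p (X m - X n) < e"
    using assms(1) e by (auto simp: padic_cauchy_def)
  obtain N where N: "\<forall>m\<ge>N. \<forall>n\<ge>N. rat_padic_abs p (Y m - Y n) < e"
    using assms(2) e by (auto simp: padic_cauchy_def)
  show "\<exists>N. \<forall>m\<ge>N. \<forall>n\<ge>N. rat_padic_abs p (X m + Y m - (X n + Y n)) < e"
  proof (intro exI[of _ "max M N"] allI impI)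
    fix m n assume "m \<ge> max M N" "n \<ge> max M N"
    then have "rat_padic_abs p (X m - X n) < e" "rat_padic_abs p (Y m - Y n) < e"
      using M N by auto
    then have "rat_padic_abs p ((X m - X n) + (Y m - Y n)) < e"
      using rat_padic_abs_add[of "X m - X n" "Y m - Y n"] by linarith
    then show "rat_padic_abs p (X m + Y m - (X n + Y n)) < e"
      by (simp add: algebra_simps)
  qed
qed

lemma padic_cauchy_minus: "padic_cauchy p X \<Longrightarrow> padic_cauchy p (\<lambda>n. - X n)"
  unfolding padic_cauchy_def
  by (metis (no_types, opaque_lifting) minus_diff_minus rat_padic_abs_minus)

lemma padic_cauchy_mult:
  assumes "padic_cauchy p X" "padic_cauchy p Y"
  shows "padic_cauchy p (\<lambda>n. X n * Y n)"
  unfolding padic_cauchy_def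
proof (intro allI impI)
  fix e :: real assume e: "e > 0"
  obtain A where A: "A > 0" "\<And>n. rat_padic_abs p (X n) \<le> A"
    using padic_cauchy_bounded[OF assms(1)] by blast
  obtain B where B: "B > 0" "\<And>n. rat_padic_abs p (Y n) \<le> B"
    using padic_cauchy_bounded[OF assms(2)] by blast
  obtain M where M: "\<forall>m\<ge>M. \<forall>n\<ge>M. rat_padic_abs p (X m - X n) < e / B"
    using assms(1) divide_pos_pos[OF e B(1)] unfolding padic_cauchy_def by blast
  obtain N where N: "\<forall>m\<ge>N. \<forall>n\<ge>N. rat_padic_abs p (Y m - Y n) < e / A"
    using assms(2) divide_pos_pos[OF e A(1)] unfolding padic_cauchy_def by blast
  show "\<exists>N. \<forall>m\<ge>N. \<forall>n\<ge>N. rat_padic_abs p (X m * Y m - X n * Y n) < e"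
  proof (intro exI[of _ "max M N"] allI impI)
    fix m n assume "m \<ge> max M N" "n \<ge> max M N"
    then have *: "rat_padic_abs p (X m - X n) < e / B" "rat_padic_abs p (Y m - Y n) < e / A"
      using M N by auto
    have "rat_padic_abs p (X m * (Y m - Y n)) < e"
    proof -
      have "rat_padic_abs p (X m * (Y m - Y n)) \<le> A * rat_padic_abs p (Y m - Y n)"
        unfolding rat_padic_abs_mult by (intro mult_right_mono A rat_padic_abs_nonneg)
      also have "\<dots> < e" using *(2) A(1) by (simp add: field_simps)
      finally show ?thesis .
    qed
    moreover have "rat_padic_abs p ((X m - X n) * Y n) < e"
    proof -
      have "rat_padic_abs p ((X m - X n) * Y n) \<le> rat_padic_abs p (X m - X n) * B"
        unfolding rat_padic_abs_mult by (intro mult_left_mono B rat_padic_abs_nonneg)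
      also have "\<dots> < e" using *(1) B(1) by (simp add: field_simps)
      finally show ?thesis .
    qed
    ultimately have "rat_padic_abs p (X m * (Y m - Y n) + (X m - X n) * Y n) < e"
      using rat_padic_abs_add[of "X m * (Y m - Y n)" "(X m - X n) * Y n"] by linarith
    then show "rat_padic_abs p (X m * Y m - X n * Y n) < e"
      by (simp add: algebra_simps)
  qed
qed

lemma padic_null_mult_cauchy:
  assumes "padic_cauchy p X" "padic_null p Y"
  shows "padic_null p (\<lambda>n. X n * Y n)"
proof -
  obtain A where A: "A > 0" "\<And>n. rat_padic_abs p (X n) \<le> A"
    using padic_cauchy_bounded[OF assms(1)] by blast
  have "(\<lambda>n. A * rat_padic_abs p (Y n)) \<longlonglongrightarrow> 0"
    using tendsto_mult_right_zero assms(2) unfolding padic_null_def by blast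
  then show ?thesis
    by (rule padic_null_squeeze)
       (auto simp: rat_padic_abs_mult intro!: mult_right_mono A rat_padic_abs_nonneg always_eventually)
qed

lemma padic_cauchy_not_null:
  assumes "padic_cauchy p X" "\<not> padic_null p X"
  obtains c N where "c > 0" "\<And>n. n \<ge> N \<Longrightarrow> rat_padic_abs p (X n) > c"
proof -
  let ?L = "lim (\<lambda>n. rat_padic_abs p (X n))"
  have L: "(\<lambda>n. rat_padic_abs p (X n)) \<longlonglongrightarrow> ?L" by (rule padic_cauchy_tendsto[OF assms(1)])
  have "?L \<ge> 0" by (rule LIMSEQ_le_const[OF L]) (simp add: rat_padic_abs_nonneg)
  moreover have "?L \<noteq> 0" using L assms(2) by (auto simp: padic_null_def)
  ultimately have "?L / 2 < ?L" "?L / 2 > 0" by auto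
  moreover from order_tendstoD(1)[OF L this(1)]
  obtain N where "\<And>n. n \<ge> N \<Longrightarrow> rat_padic_abs p (X n) > ?L / 2"
    by (auto simp: eventually_sequentially)
  ultimately show ?thesis using that by blast
qed

lemma padic_cauchy_inverse:
  assumes "padic_cauchy p X" "\<not> padic_null p X"
  shows "padic_cauchy p (\<lambda>n. inverse (X n))"
  unfolding padic_cauchy_def
proof (intro allI impI)
  fix e :: real assume e: "e > 0"
  obtain c M where c: "c > 0" and M: "\<And>n. n \<ge> M \<Longrightarrow> rat_padic_abs p (X n) > c"
    using padic_cauchy_not_null[OF assms] by blast
  have "e * (c * c) > 0" using e c by simp
  then obtain N where N: "\<forall>m\<ge>N. \<forall>n\<ge>N. rat_padic_abs p (X m - X n) < e * (c * c)"
    using assms(1) unfolding padic_cauchy_def by blast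
  show "\<exists>N. \<forall>m\<ge>N. \<forall>n\<ge>N. rat_padic_abs p (inverse (X m) - inverse (X n)) < e"
  proof (intro exI[of _ "max M N"] allI impI)
    fix m n assume mn: "m \<ge> max M N" "n \<ge> max M N"
    have cm: "rat_padic_abs p (X m) > c" and cn: "rat_padic_abs p (X n) > c" using M mn by auto
    have nz: "X m \<noteq> 0" "X n \<noteq> 0" using cm cn c by (auto simp: rat_padic_abs_zero)
    have "inverse (X m) - inverse (X n) = (X n - X m) * inverse (X m * X n)"
      using nz by (simp add: field_simps)
    then have "rat_padic_abs p (inverse (X m) - inverse (X n)) =
        rat_padic_abs p (X n - X m) / (rat_padic_abs p (X m) * rat_padic_abs p (X n))"
      by (simp only: rat_padic_abs_mult rat_padic_abs_inverse divide_inverse)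
    also have "\<dots> < e"
    proof -
      have "rat_padic_abs p (X n - X m) < e * (c * c)" using N mn by auto
      also have "\<dots> \<le> e * (rat_padic_abs p (X m) * rat_padic_abs p (X n))"
        using cm cn c e by (intro mult_left_mono mult_mono) auto
      finally show ?thesis using cm cn c by (simp add: divide_less_eq)
    qed
    finally show "rat_padic_abs p (inverse (X m) - inverse (X n)) < e" .
  qed
qed

lemma padic_null_diff_inverse:
  assumes "padic_cauchy p X" "\<not> padic_null p X" "padic_cauchy p Y" "\<not> padic_null p Y"
    and "padic_null p (\<lambda>n. X n - Y n)"
  shows "padic_null p (\<lambda>n. inverse (X n) - inverse (Y n))"
proof -
  obtain c M where c: "c > 0" and M: "\<And>n. n \<ge> M \<Longrightarrow> rat_padic_abs p (X n) > c"
    using padic_cauchy_not_null[OF assms(1,2)] by blast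
  obtain d N where d: "d > 0" and N: "\<And>n. n \<ge> N \<Longrightarrow> rat_padic_abs p (Y n) > d"
    using padic_cauchy_not_null[OF assms(3,4)] by blast
  have "padic_null p (\<lambda>n. inverse (X n) * (inverse (Y n) * (Y n - X n)))"
    by (intro padic_null_mult_cauchy padic_cauchy_inverse assms padic_null_diff_commute[of X Y])
  then have lim: "(\<lambda>n. rat_padic_abs p (inverse (X n) * (inverse (Y n) * (Y n - X n)))) \<longlonglongrightarrow> 0"
    by (simp add: padic_null_def)
  show ?thesis
  proof (rule padic_null_squeeze[OF lim], rule eventually_sequentiallyI[of "max M N"])
    fix n assume n: "n \<ge> max M N"
    then have "rat_padic_abs p (X n) > c" "rat_padic_abs p (Y n) > d" using M N by auto
    then have "X n \<noteq> 0" "Y n \<noteq> 0" using c d by (auto simp: rat_padic_abs_zero)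
    then have "inverse (X n) - inverse (Y n) = inverse (X n) * (inverse (Y n) * (Y n - X n))"
      by (simp add: field_simps)
    then show "rat_padic_abs p (inverse (X n) - inverse (Y n)) \<le>
        rat_padic_abs p (inverse (X n) * (inverse (Y n) * (Y n - X n)))" by simp
  qed
qed

lemma padic_rel_refl: "padic_cauchy p X \<Longrightarrow> padic_rel p X X"
  by (simp add: padic_rel_def padic_null_zero)

lemma padic_rel_eqI:
  "padic_cauchy p X \<Longrightarrow> padic_cauchy p Y \<Longrightarrow> (\<And>n. X n = Y n) \<Longrightarrow> padic_rel p X Y"
  by (simp add: padic_rel_def padic_null_zero)

lemma part_equivp_padic_rel: "part_equivp (padic_rel p)"
proof (rule part_equivpI)
  show "\<exists>X. padic_rel p X X" using padic_rel_refl[OF padic_cauchy_const] by blast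
  show "symp (padic_rel p)"
    by (auto simp: symp_def padic_rel_def intro: padic_null_diff_commute)
  show "transp (padic_rel p)"
  proof (rule transpI)
    fix X Y Z assume "padic_rel p X Y" "padic_rel p Y Z"
    then show "padic_rel p X Z"
      using padic_null_add[of "\<lambda>n. X n - Y n" "\<lambda>n. Y n - Z n"] by (simp add: padic_rel_def)
  qed
qed

lemma padic_rel_lim:
  assumes "padic_rel p X Y"
  shows "lim (\<lambda>n. rat_padic_abs p (X n)) = lim (\<lambda>n. rat_padic_abs p (Y n))"
proof -
  have X: "padic_cauchy p X" and Y: "padic_cauchy p Y" and n: "padic_null p (\<lambda>n. X n - Y n)"
    using assms by (auto simp: padic_rel_def)
  have "(\<lambda>n. rat_padic_abs p (X n) - rat_padic_abs p (Y n)) \<longlonglongrightarrow> 0"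
    by (rule Lim_null_comparison[OF _ n[unfolded padic_null_def]])
       (simp add: rat_padic_abs_abs_diff)
  from tendsto_diff[OF padic_cauchy_tendsto[OF X] this]
  have "(\<lambda>n. rat_padic_abs p (Y n)) \<longlonglongrightarrow> lim (\<lambda>n. rat_padic_abs p (X n))" by simp
  then show ?thesis by (simp add: limI)
qed

end


section \<open>The field of p-adic numbers\<close>

text \<open>The completion of the rationals with respect to the p-adic absolute value, as Cauchy
  sequences modulo null sequences. The prime is the cardinality of the type argument.\<close>

typedef 'a padic = "{C. \<exists>X. padic_rel CARD('a::prime_card) X X \<and> C = Collect (padic_rel CARD('a) X)}"
  using padic_rel_refl[OF prime_card padic_cauchy_const[OF prime_card]] by blast

definition abs_padic :: "(nat \<Rightarrow> rat) \<Rightarrow> 'a::prime_card padic" where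
  "abs_padic X = Abs_padic (Collect (padic_rel CARD('a) X))"

definition rep_padic :: "'a::prime_card padic \<Rightarrow> nat \<Rightarrow> rat" where
  "rep_padic x = (SOME X. X \<in> Rep_padic x)"

definition cr_padic :: "(nat \<Rightarrow> rat) \<Rightarrow> 'a::prime_card padic \<Rightarrow> bool" where
  "cr_padic X x \<longleftrightarrow> padic_rel CARD('a) X X \<and> abs_padic X = x"

lemma Quotient_padic:
  "Quotient (padic_rel CARD('a::prime_card)) abs_padic rep_padic (cr_padic :: _ \<Rightarrow> 'a padic \<Rightarrow> bool)"
proof -
  interpret quot_type "padic_rel CARD('a)" "Abs_padic :: _ \<Rightarrow> 'a padic" Rep_padic
  proof
    show "part_equivp (padic_rel CARD('a))" by (rule part_equivp_padic_rel[OF prime_card])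
    show "\<exists>X. padic_rel CARD('a) X X \<and> Rep_padic x = Collect (padic_rel CARD('a) X)"
      for x :: "'a padic" using Rep_padic[of x] by auto
    show "Abs_padic (Rep_padic x) = x" for x :: "'a padic" by (rule Rep_padic_inverse)
    show "Rep_padic (Abs_padic C :: 'a padic) = C"
      if "\<exists>X. padic_rel CARD('a) X X \<and> C = Collect (padic_rel CARD('a) X)" for C
      using that by (intro Abs_padic_inverse) simp
    show "Rep_padic x = Rep_padic y \<longleftrightarrow> x = y" for x y :: "'a padic" by (rule Rep_padic_inject)
  qed
  have "Quotient3 (padic_rel CARD('a)) abs rep" by (rule Quotient)
  moreover have "abs = (abs_padic :: _ \<Rightarrow> 'a padic)"
    by (simp add: fun_eq_iff abs_def abs_padic_def)
  moreover have "rep = (rep_padic :: 'a padic \<Rightarrow> _)"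
    by (simp add: fun_eq_iff rep_def rep_padic_def)
  ultimately have "Quotient3 (padic_rel CARD('a)) (abs_padic :: _ \<Rightarrow> 'a padic) rep_padic" by simp
  then show ?thesis
    by (rule Quotient3_to_Quotient) (rule eq_reflection, simp add: fun_eq_iff cr_padic_def)
qed

setup_lifting Quotient_padic

instantiation padic :: (prime_card) field
begin

lift_definition zero_padic :: "'a padic" is "\<lambda>n. 0"
  by (simp add: padic_rel_refl padic_cauchy_const prime_card)

lift_definition one_padic :: "'a padic" is "\<lambda>n. 1"
  by (simp add: padic_rel_refl padic_cauchy_const prime_card)

lift_definition plus_padic :: "'a padic \<Rightarrow> 'a padic \<Rightarrow> 'a padic" is "\<lambda>X Y n. X n + Y n"
  unfolding padic_rel_def add_diff_add
  by (simp add: padic_cauchy_add padic_null_add prime_card)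

lift_definition uminus_padic :: "'a padic \<Rightarrow> 'a padic" is "\<lambda>X n. - X n"
  unfolding padic_rel_def minus_diff_minus
  by (simp only: padic_cauchy_minus padic_null_minus prime_card simp_thms)

lift_definition times_padic :: "'a padic \<Rightarrow> 'a padic \<Rightarrow> 'a padic" is "\<lambda>X Y n. X n * Y n"
proof -
  fix X X' Y Y' :: "nat \<Rightarrow> rat"
  let ?p = "CARD('a)"
  assume "padic_rel ?p X X'" "padic_rel ?p Y Y'"
  then have *: "padic_cauchy ?p X" "padic_cauchy ?p X'" "padic_cauchy ?p Y" "padic_cauchy ?p Y'"
    "padic_null ?p (\<lambda>n. X n - X' n)" "padic_null ?p (\<lambda>n. Y n - Y' n)"
    by (auto simp: padic_rel_def)
  have "padic_null ?p (\<lambda>n. X n * (Y n - Y' n) + Y' n * (X n - X' n))"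
    by (intro padic_null_add padic_null_mult_cauchy prime_card *)
  moreover have "(\<lambda>n. X n * (Y n - Y' n) + Y' n * (X n - X' n)) = (\<lambda>n. X n * Y n - X' n * Y' n)"
    by (simp add: algebra_simps)
  ultimately show "padic_rel ?p (\<lambda>n. X n * Y n) (\<lambda>n. X' n * Y' n)"
    using * by (simp add: padic_rel_def padic_cauchy_mult prime_card)
qed

lift_definition inverse_padic :: "'a padic \<Rightarrow> 'a padic"
  is "\<lambda>X. if padic_null CARD('a) X then (\<lambda>n. 0) else (\<lambda>n. inverse (X n))"
proof -
  fix X Y :: "nat \<Rightarrow> rat"
  let ?p = "CARD('a)"
  assume "padic_rel ?p X Y"
  then have *: "padic_cauchy ?p X" "padic_cauchy ?p Y" "padic_null ?p (\<lambda>n. X n - Y n)"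
    by (auto simp: padic_rel_def)
  have "padic_null ?p X \<longleftrightarrow> padic_null ?p Y"
    using padic_null_diff[OF prime_card _ *(3), of X] padic_null_add[OF prime_card _ *(3), of Y]
    by auto
  then show "?thesis X Y"
    using * by (auto simp: padic_rel_def padic_cauchy_const padic_null_zero padic_cauchy_inverse
        padic_null_diff_inverse prime_card)
qed

definition "x - y = x + - y" for x y :: "'a padic"

definition "x div y = x * inverse y" for x y :: "'a padic"

instance
proof
  note cauchy_intros = padic_cauchy_add padic_cauchy_mult padic_cauchy_minus padic_cauchy_const
    padic_cauchy_inverse prime_card
  fix a b c :: "'a padic"
  show "a + b + c = a + (b + c)"
    by transfer (rule padic_rel_eqI; auto simp: padic_rel_def intro!: cauchy_intros)
  show "a + b = b + a"
    by transfer (rule padic_rel_eqI; auto simp: padic_rel_def intro!: cauchy_intros)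
  show "0 + a = a"
    by transfer (rule padic_rel_eqI; auto simp: padic_rel_def intro!: cauchy_intros)
  show "- a + a = 0"
    by transfer (rule padic_rel_eqI; auto simp: padic_rel_def intro!: cauchy_intros)
  show "a - b = a + - b" by (simp add: minus_padic_def)
  show "a * b * c = a * (b * c)"
    by transfer (rule padic_rel_eqI; auto simp: padic_rel_def intro!: cauchy_intros)
  show "a * b = b * a"
    by transfer (rule padic_rel_eqI; auto simp: padic_rel_def intro!: cauchy_intros)
  show "1 * a = a"
    by transfer (rule padic_rel_eqI; auto simp: padic_rel_def intro!: cauchy_intros)
  show "(a + b) * c = a * c + b * c"
    by transfer
      (rule padic_rel_eqI; auto simp: padic_rel_def distrib_right intro!: cauchy_intros)
  show "(0 :: 'a padic) \<noteq> 1"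
    by transfer (auto simp: padic_rel_def padic_null_def rat_padic_abs_minus rat_padic_abs_one
        prime_card LIMSEQ_const_iff)
  show "inverse (0 :: 'a padic) = 0"
    by transfer (simp add: padic_null_zero padic_rel_refl padic_cauchy_const prime_card)
  show "a div b = a * inverse b" by (simp add: divide_padic_def)
  show "inverse a * a = 1" if "a \<noteq> 0"
    using that
  proof transfer
    fix X :: "nat \<Rightarrow> rat"
    let ?p = "CARD('a)"
    assume X: "padic_rel ?p X X" and nz: "\<not> padic_rel ?p X (\<lambda>n. 0)"
    have cX: "padic_cauchy ?p X" using X by (simp add: padic_rel_def)
    have nn: "\<not> padic_null ?p X"
      using nz cX by (simp add: padic_rel_def padic_cauchy_const prime_card)
    obtain c N where c: "c > 0" and N: "\<And>n. n \<ge> N \<Longrightarrow> rat_padic_abs ?p (X n) > c"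
      using padic_cauchy_not_null[OF prime_card cX nn] by blast
    have "inverse (X n) * X n - 1 = 0" if "n \<ge> N" for n
    proof -
      have "X n \<noteq> 0" using N[OF that] c by (auto simp: rat_padic_abs_zero prime_card)
      then show ?thesis by simp
    qed
    then have "padic_null ?p (\<lambda>n. inverse (X n) * X n - 1)"
      by (intro padic_null_squeeze[OF prime_card tendsto_const] eventually_sequentiallyI[of N])
         (simp add: rat_padic_abs_zero prime_card)
    then show "padic_rel ?p (\<lambda>n. (if padic_null ?p X then \<lambda>n. 0 else (\<lambda>n. inverse (X n))) n * X n)
        (\<lambda>n. 1)"
      using nn cX by (simp add: padic_rel_def padic_cauchy_const padic_cauchy_mult
          padic_cauchy_inverse prime_card)
  qed
qed

end

lift_definition padic_const :: "rat \<Rightarrow> 'p::prime_card padic" is "\<lambda>x n. x"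
  by (simp add: padic_rel_refl padic_cauchy_const prime_card)

lemma of_nat_padic: "of_nat n = (padic_const (of_nat n) :: 'p::prime_card padic)"
proof (induction n)
  case 0
  show ?case unfolding of_nat_0
    by transfer (simp add: padic_rel_refl padic_cauchy_const prime_card)
next
  case (Suc n)
  show ?case unfolding of_nat_Suc Suc
    by transfer (simp add: padic_rel_refl padic_cauchy_const prime_card)
qed

lemma padic_const_eq_iff: "(padic_const x :: 'p::prime_card padic) = padic_const y \<longleftrightarrow> x = y"
  by transfer (auto simp: padic_rel_def padic_null_def LIMSEQ_const_iff
      rat_padic_abs_eq_0_iff padic_cauchy_const prime_card)

instance padic :: (prime_card) field_char_0
  by standard (simp add: inj_def of_nat_padic padic_const_eq_iff)

lift_definition padic_abs :: "'p::prime_card padic \<Rightarrow> real"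
  is "\<lambda>X. lim (\<lambda>n. rat_padic_abs CARD('p) (X n))"
  by (rule padic_rel_lim[OF prime_card])

lemma of_rat_padic: "of_rat x = (padic_const x :: 'p::prime_card padic)"
proof -
  obtain a b :: int where x: "x = of_int a / of_int b" "b > 0"
    by (metis quotient_of_div quotient_of_denom_pos surj_pair)
  have mult: "padic_const (y * z) = (padic_const y * padic_const z :: 'p padic)" for y z
    by transfer (simp add: padic_rel_refl padic_cauchy_const prime_card)
  have minus: "padic_const (- y) = (- padic_const y :: 'p padic)" for y
    by transfer (simp add: padic_rel_refl padic_cauchy_const prime_card)
  have int: "of_int c = (padic_const (of_int c) :: 'p padic)" for c
    by (cases c rule: int_cases2) (simp_all add: of_nat_padic minus)
  have "padic_const x * (of_int b :: 'p padic) = of_int a"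
    unfolding int mult[symmetric] using x by simp
  then show ?thesis using x by (simp add: of_rat_divide divide_eq_eq)
qed

lemma padic_abs_of_rat: "padic_abs (of_rat x :: 'p::prime_card padic) = rat_padic_abs CARD('p) x"
  unfolding of_rat_padic by transfer simp


section \<open>The p-adic Jacobi--Perron algorithm\<close>

definition Z_inv_p :: "nat \<Rightarrow> rat set" where
  "Z_inv_p p = {of_int m / of_nat p ^ k |m k. True}"

definition balanced_expansion :: "'p::prime_card padic \<Rightarrow> int \<Rightarrow> (int \<Rightarrow> int) \<Rightarrow> bool" where
  "balanced_expansion \<alpha> k x \<longleftrightarrow>
     (\<forall>j\<ge>k. - (real CARD('p) / 2) < real_of_int (x j) \<and> real_of_int (x j) < real CARD('p) / 2) \<and>
     (\<lambda>n. padic_abs (\<alpha> - (\<Sum>j=k..int n. of_int (x j) * of_nat CARD('p) powi j))) \<longlonglongrightarrow> 0"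

text \<open>Browkin's s-function, with values in the rationals; the value does not depend on the choice
  of the starting index \<open>k\<close>, and the sum is empty for \<open>k > 0\<close>. For p = 2 expansions with
  digits in the open interval need not exist, so it is only meaningful for odd p.\<close>

definition browkin_s :: "'p::prime_card padic \<Rightarrow> rat" where
  "browkin_s \<alpha> = (THE r. \<exists>k x. balanced_expansion \<alpha> k x \<and>
     r = (\<Sum>j=k..0. of_int (x j) * of_nat CARD('p) powi j))"

text \<open>\<open>None\<close> means that the algorithm has stopped at an earlier step.\<close>

primrec jp_complete ::
    "'p::prime_card padic \<Rightarrow> 'p padic \<Rightarrow> nat \<Rightarrow> ('p padic \<times> 'p padic) option" where
  "jp_complete \<alpha> \<beta> 0 = Some (\<alpha>, \<beta>)"
| "jp_complete \<alpha> \<beta> (Suc k) =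
     (case jp_complete \<alpha> \<beta> k of
        None \<Rightarrow> None
      | Some (x, y) \<Rightarrow>
          let a = of_rat (browkin_s x); b = of_rat (browkin_s y)
          in if y = b then None else Some (1 / (y - b), (x - a) / (y - b)))"

definition jp_length_ge :: "'p::prime_card padic \<Rightarrow> 'p padic \<Rightarrow> nat \<Rightarrow> bool" where
  "jp_length_ge \<alpha> \<beta> N \<longleftrightarrow> jp_complete \<alpha> \<beta> N \<noteq> None"

text \<open>The partial quotients; arbitrary if the expansion has length below \<open>k\<close>.
  The \<open>b\<close>-quotients enter only through the algorithm itself.\<close>

definition jp_a :: "'p::prime_card padic \<Rightarrow> 'p padic \<Rightarrow> nat \<Rightarrow> rat" where
  "jp_a \<alpha> \<beta> k = browkin_s (fst (the (jp_complete \<alpha> \<beta> k)))"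

definition jp_k :: "'p::prime_card padic \<Rightarrow> 'p padic \<Rightarrow> nat \<Rightarrow> int" where
  "jp_k \<alpha> \<beta> n = rat_padic_val CARD('p) (1 / jp_a \<alpha> \<beta> n)"

definition jp_K :: "'p::prime_card padic \<Rightarrow> 'p padic \<Rightarrow> nat \<Rightarrow> int" where
  "jp_K \<alpha> \<beta> n = (\<Sum>i=1..n. jp_k \<alpha> \<beta> i)"

definition x_tilde :: "nat \<Rightarrow> real" where
  "x_tilde p = (THE x. x > 0 \<and>
     x ^ 3 - 1 / 2 * x ^ 2 - 1 / (2 * real p) * x - 1 / real p ^ 3 = 0)"

end

theory Submission
  imports Defs
begin

text \<open>Run the homogeneous form of the algorithm on the vector \<open>(t, u, v)\<close>, but with the partial
  quotients of \<open>(\<alpha>, \<beta>)\<close>, and let \<open>w\<close> be the last entry after \<open>n + 1\<close> steps. Since \<open>(t/v, u/v)\<close>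
  is p-adically close to \<open>(\<alpha>, \<beta>)\<close>, the p-adic absolute value of the last entry is divided by
  \<open>p^k\<^sub>i\<close> in step \<open>i\<close>, so \<open>w\<close> is a nonzero integer divisible by \<open>p ^ (n + 1)\<close>. On the other hand
  all partial quotients are at most \<open>p/2\<close> in real absolute value, so the real absolute values of the
  last entries grow at most like a linear recurrence of order 3 whose characteristic root is \<open>p\<close>
  times \<open>x_tilde p\<close>. Comparing the two bounds for \<open>w\<close> gives the theorem.\<close>

subsection \<open>The absolute value of a p-adic number\<close>

lemma CARD_prime_gt_1: "real CARD('p::prime_card) > 1"
  using prime_gt_1_nat[OF prime_card[where 'a = 'p]] by simp

lemma padic_abs_nonneg: "padic_abs (x :: 'p::prime_card padic) \<ge> 0"
proof transfer
  fix X :: "nat \<Rightarrow> rat" assume "padic_rel CARD('p) X X"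
  then have "padic_cauchy CARD('p) X" by (simp add: padic_rel_def)
  from padic_cauchy_tendsto[OF prime_card this]
  show "0 \<le> lim (\<lambda>n. rat_padic_abs CARD('p) (X n))"
    by (rule LIMSEQ_le_const) (simp add: rat_padic_abs_nonneg prime_card)
qed

lemma padic_abs_eq_0_iff: "padic_abs (x :: 'p::prime_card padic) = 0 \<longleftrightarrow> x = 0"
proof transfer
  fix X :: "nat \<Rightarrow> rat" assume "padic_rel CARD('p) X X"
  then have c: "padic_cauchy CARD('p) X" by (simp add: padic_rel_def)
  note t = padic_cauchy_tendsto[OF prime_card c]
  show "lim (\<lambda>n. rat_padic_abs CARD('p) (X n)) = 0 \<longleftrightarrow> padic_rel CARD('p) X (\<lambda>n. 0)"
  proof
    assume "lim (\<lambda>n. rat_padic_abs CARD('p) (X n)) = 0"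
    then show "padic_rel CARD('p) X (\<lambda>n. 0)"
      using t c by (simp add: padic_rel_def padic_null_def padic_cauchy_const prime_card)
  next
    assume "padic_rel CARD('p) X (\<lambda>n. 0)"
    then have "(\<lambda>n. rat_padic_abs CARD('p) (X n)) \<longlonglongrightarrow> 0"
      by (simp add: padic_rel_def padic_null_def)
    then show "lim (\<lambda>n. rat_padic_abs CARD('p) (X n)) = 0" by (rule limI)
  qed
qed

lemma padic_abs_mult: "padic_abs (x * y) = padic_abs x * padic_abs (y :: 'p::prime_card padic)"
proof transfer
  fix X Y :: "nat \<Rightarrow> rat" assume "padic_rel CARD('p) X X" "padic_rel CARD('p) Y Y"
  then have c: "padic_cauchy CARD('p) X" "padic_cauchy CARD('p) Y" by (simp_all add: padic_rel_def)
  show "lim (\<lambda>n. rat_padic_abs CARD('p) (X n * Y n)) =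
      lim (\<lambda>n. rat_padic_abs CARD('p) (X n)) * lim (\<lambda>n. rat_padic_abs CARD('p) (Y n))"
    unfolding rat_padic_abs_mult[OF prime_card]
    by (intro limI tendsto_mult padic_cauchy_tendsto prime_card c)
qed

lemma padic_abs_add:
  "padic_abs (x + y) \<le> max (padic_abs x) (padic_abs (y :: 'p::prime_card padic))"
proof transfer
  fix X Y :: "nat \<Rightarrow> rat" assume "padic_rel CARD('p) X X" "padic_rel CARD('p) Y Y"
  then have c: "padic_cauchy CARD('p) X" "padic_cauchy CARD('p) Y" by (simp_all add: padic_rel_def)
  show "lim (\<lambda>n. rat_padic_abs CARD('p) (X n + Y n)) \<le>
      max (lim (\<lambda>n. rat_padic_abs CARD('p) (X n))) (lim (\<lambda>n. rat_padic_abs CARD('p) (Y n)))"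
    by (rule LIMSEQ_le[OF padic_cauchy_tendsto[OF prime_card padic_cauchy_add[OF prime_card c]]
          tendsto_max[OF padic_cauchy_tendsto[OF prime_card c(1)] padic_cauchy_tendsto[OF prime_card c(2)]]])
       (simp add: rat_padic_abs_add prime_card)
qed

lemma padic_abs_one: "padic_abs (1 :: 'p::prime_card padic) = 1"
  using padic_abs_of_rat[where 'p = 'p, of 1] by (simp add: rat_padic_abs_one prime_card)

lemma padic_abs_minus: "padic_abs (- x) = padic_abs (x :: 'p::prime_card padic)"
proof -
  have "padic_abs (- 1 :: 'p padic) = 1"
    using padic_abs_of_rat[where 'p = 'p, of "- 1"]
    by (simp add: of_rat_minus rat_padic_abs_minus rat_padic_abs_one prime_card)
  then show ?thesis using padic_abs_mult[of "- 1" x] by simp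
qed

lemma padic_abs_diff:
  "padic_abs (x - y) \<le> max (padic_abs x) (padic_abs (y :: 'p::prime_card padic))"
  using padic_abs_add[of x "- y"] by (simp add: padic_abs_minus)

lemma padic_abs_diff_commute: "padic_abs (x - y) = padic_abs (y - x :: 'p::prime_card padic)"
  using padic_abs_minus[of "x - y"] by simp

lemma padic_abs_inverse: "padic_abs (inverse x) = inverse (padic_abs (x :: 'p::prime_card padic))"
proof (cases "x = 0")
  case True
  then show ?thesis using padic_abs_eq_0_iff[of x] by simp
next
  case False
  then have "padic_abs x * padic_abs (inverse x) = 1"
    using padic_abs_mult[of x "inverse x"] by (simp add: padic_abs_one)
  then show ?thesis by (metis inverse_unique)
qed

lemma padic_abs_divide: "padic_abs (x / y) = padic_abs x / padic_abs (y :: 'p::prime_card padic)"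
  by (simp add: divide_inverse padic_abs_mult padic_abs_inverse)

text \<open>Since \<open>y = (x + y) - x\<close>, the ultrametric bound for
  \<open>padic_abs y\<close> is a maximum that only the term \<open>padic_abs (x + y)\<close> can
  attain.\<close>

lemma padic_abs_add_dominant:
  assumes "padic_abs x < padic_abs (y :: 'p::prime_card padic)"
  shows "padic_abs (x + y) = padic_abs y"
  using padic_abs_add[of x y] padic_abs_diff[of "x + y" x] assms by (simp add: max_def split: if_splits)

lemma padic_abs_eq_of_diff_less:
  assumes "padic_abs (x - y) < padic_abs (y :: 'p::prime_card padic)"
  shows "padic_abs x = padic_abs y"
  using padic_abs_add_dominant[OF assms] by simp

section \<open>Density of the rationals and discreteness of the absolute value\<close>

lemma rat_dense_in_padic:
  assumes "e > 0"
  obtains q where "padic_abs (x - of_rat q :: 'p::prime_card padic) < e"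
proof -
  have "\<exists>q. padic_abs (x + - padic_const q :: 'p padic) < e"
    using assms
  proof transfer
    fix e :: real and X :: "nat \<Rightarrow> rat"
    assume e: "e > 0" and "padic_rel CARD('p) X X"
    then have c: "padic_cauchy CARD('p) X" by (simp add: padic_rel_def)
    \<comment> \<open>Half of \<open>e\<close>, because passing to the limit below weakens
      \<open><\<close> to \<le>. The term \<open>X N\<close> serves as the rational.\<close>
    then obtain N where N: "\<forall>m\<ge>N. \<forall>n\<ge>N. rat_padic_abs CARD('p) (X m - X n) < e / 2"
      using half_gt_zero[OF e] unfolding padic_cauchy_def by blast
    have "padic_cauchy CARD('p) (\<lambda>n. X n + - X N)"
      by (intro padic_cauchy_add padic_cauchy_const prime_card c)
    from padic_cauchy_tendsto[OF prime_card this]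
    have "lim (\<lambda>n. rat_padic_abs CARD('p) (X n + - X N)) \<le> e / 2"
      by (rule LIMSEQ_le_const2) (use N in \<open>auto intro!: exI[of _ N] less_imp_le\<close>)
    also have "\<dots> < e" using e by simp
    finally show "\<exists>q. lim (\<lambda>n. rat_padic_abs CARD('p) (X n + - q)) < e" by (rule exI[of _ "X N"])
  qed
  then show ?thesis using that unfolding of_rat_padic by auto
qed

text \<open>A rational closer to \<open>x\<close> than \<open>padic_abs x\<close> has the same
  absolute value, and the values at nonzero rationals are integral powers of the prime.\<close>

lemma padic_abs_discrete:
  assumes "x \<noteq> (0 :: 'p::prime_card padic)"
  obtains m where "padic_abs x = real CARD('p) powi m"
proof -
  have "padic_abs x > 0" using assms padic_abs_eq_0_iff[of x] padic_abs_nonneg[of x] by linarith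
  then obtain q where "padic_abs (x - of_rat q) < padic_abs x" by (rule rat_dense_in_padic)
  then have x: "padic_abs x = padic_abs (of_rat q :: 'p padic)"
    using padic_abs_eq_of_diff_less[of "of_rat q" x] padic_abs_diff_commute[of x] by simp
  then have "q \<noteq> 0" using assms padic_abs_eq_0_iff[of x] padic_abs_eq_0_iff[of "of_rat q :: 'p padic"] by auto
  then show ?thesis using that x by (simp add: padic_abs_of_rat rat_padic_abs_def)
qed

text \<open>This gain of a full factor of the prime keeps remainders in the unit ball after division
  by the prime, and makes the difference of two candidate s-values too large.\<close>

lemma padic_abs_lt_1_imp_le:
  assumes "padic_abs (x :: 'p::prime_card padic) < 1"
  shows "padic_abs x \<le> 1 / real CARD('p)"
proof (cases "x = 0")
  case True
  then show ?thesis using padic_abs_eq_0_iff[of x] by simp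
next
  case False
  then obtain m where m: "padic_abs x = real CARD('p) powi m" by (rule padic_abs_discrete)
  have "m < 0"
  proof (rule ccontr)
    assume "\<not> m < 0"
    then have "real CARD('p) powi 0 \<le> real CARD('p) powi m"
      using CARD_prime_gt_1[where 'p = 'p] by (intro power_int_increasing) auto
    then show False using assms m by simp
  qed
  then have "real CARD('p) powi m \<le> real CARD('p) powi (- 1)"
    using CARD_prime_gt_1[where 'p = 'p] by (intro power_int_increasing) auto
  then show ?thesis using m by (simp add: power_int_minus divide_inverse)
qed

section \<open>Absolute values of integers and of powers of the prime\<close>

lemma rat_padic_abs_of_int_le_1:
  assumes "prime p" shows "rat_padic_abs p (of_int c) \<le> 1"
proof (cases "c = 0")
  case False
  then have "rat_padic_val p (of_int c) \<ge> 0"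
    using rat_padic_val_frac[OF assms, of c 1] by simp
  then have "real p powi (- rat_padic_val p (of_int c)) \<le> real p powi 0"
    using prime_ge_1_nat[OF assms] by (intro power_int_increasing) auto
  then show ?thesis by (simp add: rat_padic_abs_def)
qed (simp add: rat_padic_abs_def)

lemma rat_padic_abs_p:
  assumes "prime p" shows "rat_padic_abs p (of_nat p) = 1 / real p"
proof -
  have "rat_padic_val p (of_nat p) = 1"
    using rat_padic_val_frac[OF assms, of "int p" 1] prime_gt_0_nat[OF assms]
      assms not_prime_unit[of "int p"]
    by (auto intro: multiplicity_self)
  then show ?thesis using prime_gt_0_nat[OF assms]
    by (simp add: rat_padic_abs_def power_int_minus divide_inverse)
qed

lemma padic_abs_of_int_le_1: "padic_abs (of_int c :: 'p::prime_card padic) \<le> 1"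
  using rat_padic_abs_of_int_le_1[OF prime_card[where 'a = 'p], of c] padic_abs_of_rat[where 'p='p, of "of_int c"]
  by simp

lemma padic_abs_p: "padic_abs (of_nat CARD('p) :: 'p::prime_card padic) = 1 / real CARD('p)"
  using rat_padic_abs_p[OF prime_card[where 'a = 'p]] padic_abs_of_rat[where 'p='p, of "of_nat CARD('p)"]
  by simp

lemma padic_abs_power: "padic_abs (x ^ n :: 'p::prime_card padic) = padic_abs x ^ n"
  by (induction n) (simp_all add: padic_abs_one padic_abs_mult)

lemma padic_abs_p_powi:
  "padic_abs (of_nat CARD('p) powi j :: 'p::prime_card padic) = real CARD('p) powi (- j)"
proof (cases "j \<ge> 0")
  case True
  then show ?thesis
    by (simp add: power_int_def padic_abs_power padic_abs_p power_one_over inverse_eq_divide)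
next
  case False
  then show ?thesis
    by (simp add: power_int_def padic_abs_power padic_abs_inverse padic_abs_p power_one_over
        flip: power_inverse)
qed

lemma padic_abs_of_int_dvd:
  assumes "int CARD('p) dvd c"
  shows "padic_abs (of_int c :: 'p::prime_card padic) < 1"
proof -
  obtain d where "c = int CARD('p) * d" using assms by blast
  then have "padic_abs (of_int c :: 'p padic) = padic_abs (of_int d :: 'p padic) / real CARD('p)"
    by (simp add: padic_abs_mult padic_abs_p)
  also have "\<dots> < 1"
    using padic_abs_of_int_le_1[of d, where 'p = 'p] CARD_prime_gt_1[where 'p = 'p]
    by (simp add: divide_less_eq)
  finally show ?thesis .
qed

lemma dvd_of_padic_abs_of_int:
  assumes "padic_abs (of_int c :: 'p::prime_card padic) < 1"
  shows "int CARD('p) dvd c"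
proof (rule ccontr)
  assume n: "\<not> int CARD('p) dvd c"
  then have "c \<noteq> 0" by auto
  moreover have "multiplicity (int CARD('p)) c = 0" using n by (simp add: not_dvd_imp_multiplicity_0)
  ultimately have "rat_padic_abs CARD('p) (of_int c) = 1"
    using rat_padic_val_frac[OF prime_card[where 'a='p], of c 1] by (simp add: rat_padic_abs_def)
  then show False using assms padic_abs_of_rat[where 'p='p, of "of_int c"] by simp
qed

subsection \<open>The ring of fractions with p-power denominators\<close>

lemma Z_inv_p_of_int: "of_int m \<in> Z_inv_p p"
  unfolding Z_inv_p_def by (rule CollectI, rule exI[of _ m], rule exI[of _ 0]) simp

lemma Z_inv_p_mult:
  assumes "x \<in> Z_inv_p p" "y \<in> Z_inv_p p" shows "x * y \<in> Z_inv_p p"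
proof -
  obtain a i b j where "x = of_int a / of_nat p ^ i" "y = of_int b / of_nat p ^ j"
    using assms by (auto simp: Z_inv_p_def)
  then have "x * y = of_int (a * b) / of_nat p ^ (i + j)" by (simp add: power_add)
  then show ?thesis unfolding Z_inv_p_def by blast
qed

lemma Z_inv_p_minus: "x \<in> Z_inv_p p \<Longrightarrow> - x \<in> Z_inv_p p"
  using Z_inv_p_mult[OF Z_inv_p_of_int[of "- 1"]] by simp

lemma Z_inv_p_add:
  assumes "p > 0" "x \<in> Z_inv_p p" "y \<in> Z_inv_p p" shows "x + y \<in> Z_inv_p p"
proof -
  obtain a i b j where "x = of_int a / of_nat p ^ i" "y = of_int b / of_nat p ^ j"
    using assms by (auto simp: Z_inv_p_def)
  then have "x + y = of_int (a * int p ^ j + b * int p ^ i) / of_nat p ^ (i + j)"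
    using assms(1) by (simp add: power_add add_divide_distrib)
  then show ?thesis unfolding Z_inv_p_def by blast
qed

lemma Z_inv_p_diff:
  "p > 0 \<Longrightarrow> x \<in> Z_inv_p p \<Longrightarrow> y \<in> Z_inv_p p \<Longrightarrow> x - y \<in> Z_inv_p p"
  using Z_inv_p_add[of p x "- y"] Z_inv_p_minus[of y p] by simp

lemma Z_inv_p_sum:
  "p > 0 \<Longrightarrow> (\<And>i. i \<in> A \<Longrightarrow> f i \<in> Z_inv_p p) \<Longrightarrow> sum f A \<in> Z_inv_p p"
  by (induction A rule: infinite_finite_induct)
     (use Z_inv_p_of_int[of 0 p] in \<open>auto intro: Z_inv_p_add\<close>)

lemma Z_inv_p_powi: "of_nat p powi j \<in> Z_inv_p p"
proof (cases "j \<ge> 0")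
  case True
  then have "(of_nat p powi j :: rat) = of_int (int p ^ nat j)" by (simp add: power_int_def)
  then show ?thesis by (metis Z_inv_p_of_int)
next
  case False
  then have "(of_nat p powi j :: rat) = of_int 1 / of_nat p ^ nat (- j)"
    by (simp add: power_int_def inverse_eq_divide power_one_over)
  then show ?thesis unfolding Z_inv_p_def by blast
qed

text \<open>The product formula: all other absolute values of \<open>z\<close> are at most 1.\<close>

lemma Z_inv_p_abs_ge:
  assumes p: "prime p" and z: "z \<in> Z_inv_p p" "z \<noteq> 0"
    and le: "rat_padic_abs p z \<le> real p powi (- m)"
  shows "real p powi m \<le> real_of_rat \<bar>z\<bar>"
proof -
  obtain a k where a: "z = of_int a / of_nat p ^ k" using z(1) by (auto simp: Z_inv_p_def)
  have p1: "real p > 1" using prime_gt_1_nat[OF p] by simp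
  have a0: "a \<noteq> 0" using z a by auto
  let ?e = "multiplicity (int p) a"
  have np: "\<not> is_unit (int p)" using p not_prime_unit[of "int p"] by auto
  have "multiplicity (int p) (int p ^ k) = k"
    using np p1 by (intro multiplicity_same_power) auto
  then have "rat_padic_val p z = int ?e - int k"
    using rat_padic_val_frac[OF p a0, of "int p ^ k"] p1 a by simp
  then have "real p powi (int k - int ?e) \<le> real p powi (- m)"
    using le z(2) by (simp add: rat_padic_abs_def)
  then have m: "m \<le> int ?e - int k"
    using p1 power_int_strict_increasing[of "- m" "int k - int ?e" "real p"] by linarith
  \<comment> \<open>The \<open>p\<close>-part of the nonzero numerator divides it and so is at most
    its real absolute value; the denominator is itself a power of \<open>p\<close>.\<close>
  have "int p ^ ?e \<le> \<bar>a\<bar>" using multiplicity_dvd[of "int p" a] a0 by (intro zdvd_imp_le) auto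
  then have "real p ^ ?e \<le> \<bar>real_of_int a\<bar>"
    by (metis of_int_abs of_int_le_iff of_int_of_nat_eq of_int_power)
  then have "real p ^ ?e / real p ^ k \<le> \<bar>real_of_int a\<bar> / real p ^ k" by (simp add: divide_right_mono)
  also have "\<dots> = real_of_rat \<bar>z\<bar>" 
  proof -
    have "\<bar>z\<bar> = of_int \<bar>a\<bar> / of_nat p ^ k" using p1 by (simp add: a)
    then show ?thesis by (simp add: of_rat_divide of_rat_power del: of_int_abs) simp
  qed
  finally have "real p powi (int ?e - int k) \<le> real_of_rat \<bar>z\<bar>"
    using p1 by (simp add: power_int_diff)
  moreover have "real p powi m \<le> real p powi (int ?e - int k)"
    using m p1 by (intro power_int_increasing) auto
  ultimately show ?thesis by linarith
qed

subsection \<open>Browkin's s-function\<close>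

text \<open>A rational \<open>a / b\<close> close to \<gamma> has denominator prime to
  \<open>p\<close>, so the digit is \<open>a\<close> times an inverse of \<open>b\<close> modulo
  \<open>p\<close>, reduced to the symmetric range, which is a full residue system for odd
  \<open>p\<close>.\<close>

lemma balanced_digit_exists:
  fixes \<gamma> :: "'p::prime_card padic"
  assumes odd: "odd CARD('p)" and \<gamma>: "padic_abs \<gamma> \<le> 1"
  obtains d :: int where "\<bar>real_of_int d\<bar> < real CARD('p) / 2" "padic_abs (\<gamma> - of_int d) < 1"
proof -
  let ?p = "int CARD('p)"
  obtain q where q: "padic_abs (\<gamma> - of_rat q) < 1" using rat_dense_in_padic[of 1 \<gamma>] by auto
  have q1: "padic_abs (of_rat q :: 'p padic) \<le> 1"
    using padic_abs_diff[of \<gamma> "\<gamma> - of_rat q"] \<gamma> q by simp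
  obtain a b where ab: "quotient_of q = (a, b)" by (metis surj_pair)
  have b0: "b > 0" using ab quotient_of_denom_pos by blast
  have qab: "(of_rat q :: 'p padic) = of_int a / of_int b"
    using quotient_of_div[OF ab] by (simp add: of_rat_divide)
  have cop: "coprime a b" using ab quotient_of_coprime by blast
  have prime: "prime ?p" using prime_card[where 'a = 'p] by simp
  \<comment> \<open>Otherwise the numerator would be divisible by the prime as well, although the
    fraction is reduced.\<close>
  have nd: "\<not> ?p dvd b"
  proof
    assume b: "?p dvd b"
    have ltb: "padic_abs (of_int b :: 'p padic) < 1" by (rule padic_abs_of_int_dvd[OF b])
    have "padic_abs (of_int a :: 'p padic) = padic_abs (of_rat q :: 'p padic) * padic_abs (of_int b :: 'p padic)"
      unfolding qab using b0 by (simp flip: padic_abs_mult)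
    also have "\<dots> < 1"
      using mult_right_mono[OF q1 padic_abs_nonneg[of "of_int b :: 'p padic"]] ltb by linarith
    finally have "?p dvd a" by (rule dvd_of_padic_abs_of_int)
    then show False using b cop prime by (meson not_coprimeI not_prime_unit)
  qed
  have "coprime b ?p" using prime nd by (metis coprime_commute prime_imp_coprime)
  then obtain c where "[b * c = 1] (mod ?p)" using cong_solve_coprime_int by blast
  then have c: "?p dvd b * c - 1" by (simp add: cong_iff_dvd_diff)
  \<comment> \<open>Shifting by \<open>h\<close> before and after the reduction moves the residues
    from \<open>{0..2 * h}\<close> to \<open>{- h..h}\<close>.\<close>
  define h where "h = (?p - 1) div 2"
  define d where "d = (a * c + h) mod ?p - h"
  have h: "?p = 2 * h + 1" using odd unfolding h_def by simp
  have h0: "?p > 0" using prime by (simp add: prime_gt_0_int)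
  have d: "- h \<le> d" "d \<le> h" using pos_mod_bound[OF h0, of "a * c + h"] pos_mod_sign[OF h0, of "a * c + h"] h
    unfolding d_def by linarith+
  then have "\<bar>2 * d\<bar> < ?p" using h by linarith
  then have "real_of_int \<bar>2 * d\<bar> < real_of_int ?p" by (simp only: of_int_less_iff)
  then have dp: "\<bar>real_of_int d\<bar> < real CARD('p) / 2" by simp
  have "(a * c + h) mod ?p = a * c + h - ?p * ((a * c + h) div ?p)" by (rule minus_mult_div_eq_mod[symmetric])
  then have "a * c - d = ?p * ((a * c + h) div ?p)" unfolding d_def by linarith
  then have "?p dvd a * c - d" by simp
  moreover have "?p dvd a * (b * c - 1)" using c by simp
  \<comment> \<open>The combination eliminates \<open>c\<close>: it leaves \<open>b * d - a\<close>,
    so \<open>d\<close> is congruent to \<open>a / b\<close>.\<close>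
  ultimately have "?p dvd a * (b * c - 1) - b * (a * c - d)" by (intro dvd_diff) auto
  also have "a * (b * c - 1) - b * (a * c - d) = b * d - a" by (simp add: algebra_simps)
  finally have "padic_abs (of_int (b * d - a) :: 'p padic) < 1" by (rule padic_abs_of_int_dvd)
  moreover have "padic_abs (of_int b :: 'p padic) = 1"
    using nd dvd_of_padic_abs_of_int[of b, where 'p = 'p] padic_abs_of_int_le_1[of b, where 'p = 'p]
    by linarith
  moreover have "(of_int d :: 'p padic) - of_rat q = of_int (b * d - a) / of_int b"
    unfolding qab using b0 by (simp add: field_simps)
  ultimately have "padic_abs ((of_int d :: 'p padic) - of_rat q) < 1"
    by (simp add: padic_abs_divide del: of_int_diff of_int_mult)
  then have "padic_abs ((\<gamma> - of_rat q) - (of_int d - of_rat q)) < 1"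
    using padic_abs_diff[of "\<gamma> - of_rat q" "of_int d - of_rat q"] q by linarith
  then show ?thesis using that dp by simp
qed

text \<open>Scale \<alpha> into the unit ball by a power of the prime, then repeatedly subtract a
  digit and divide by the prime; \<open>g i\<close> is the remainder after \<open>i\<close>
  digits.\<close>

lemma balanced_expansion_exists:
  fixes \<alpha> :: "'p::prime_card padic"
  assumes odd: "odd CARD('p)"
  obtains k x where "balanced_expansion \<alpha> k x"
proof -
  let ?P = "of_nat CARD('p) :: 'p padic"
  have P0: "?P \<noteq> 0" by simp
  note p1 = CARD_prime_gt_1[where 'p = 'p]
  obtain m where m: "padic_abs \<alpha> < real CARD('p) ^ m" using real_arch_pow[OF p1] by blast
  define k where "k = - int m"
  \<comment> \<open>The condition on \<gamma> stands inside the existential so that choice yields a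
    total digit function \<open>D\<close>.\<close>
  have "\<forall>\<gamma>. \<exists>d. padic_abs (\<gamma> :: 'p padic) \<le> 1 \<longrightarrow>
      \<bar>real_of_int d\<bar> < real CARD('p) / 2 \<and> padic_abs (\<gamma> - of_int d) < 1"
  proof
    fix \<gamma> :: "'p padic"
    show "\<exists>d. padic_abs \<gamma> \<le> 1 \<longrightarrow>
      \<bar>real_of_int d\<bar> < real CARD('p) / 2 \<and> padic_abs (\<gamma> - of_int d) < 1"
      by (cases "padic_abs \<gamma> \<le> 1") (use balanced_digit_exists[OF odd, of \<gamma>] in auto)
  qed
  from choice[OF this] obtain D :: "'p padic \<Rightarrow> int" where
    D: "\<And>\<gamma>. padic_abs \<gamma> \<le> 1 \<Longrightarrow>
      \<bar>real_of_int (D \<gamma>)\<bar> < real CARD('p) / 2 \<and> padic_abs (\<gamma> - of_int (D \<gamma>)) < 1"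
    by blast
  define g where "g i = ((\<lambda>\<gamma>. (\<gamma> - of_int (D \<gamma>)) / ?P) ^^ i) (\<alpha> * ?P ^ m)" for i
  have gSuc: "g i = of_int (D (g i)) + ?P * g (Suc i)" for i
    unfolding g_def using P0 by (simp add: field_simps)
  have g1: "padic_abs (g i) \<le> 1" for i
  proof (induction i)
    case 0
    have "padic_abs (g 0) = padic_abs \<alpha> / real CARD('p) ^ m"
      by (simp add: g_def padic_abs_mult padic_abs_power padic_abs_p power_one_over)
    then show ?case using m p1 by simp
  next
    case (Suc i)
    have "padic_abs (g (Suc i)) = padic_abs (g i - of_int (D (g i))) * real CARD('p)"
      by (simp add: g_def padic_abs_divide padic_abs_p)
    also have "\<dots> \<le> 1"
      using padic_abs_lt_1_imp_le[of "g i - of_int (D (g i))"] D[OF Suc] p1 by (simp add: field_simps)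
    finally show ?case .
  qed
  define x where "x j = D (g (nat (j - k)))" for j
  \<comment> \<open>Telescoping of \<open>gSuc\<close>; here \<open>i\<close> counts digits, so
    \<open>i = 0\<close> is the empty sum.\<close>
  have partial: "(\<Sum>j=k..k + int i - 1. of_int (x j) * ?P powi j) = \<alpha> - ?P powi (k + int i) * g i" for i
  proof (induction i)
    case 0
    have "?P powi k * g 0 = \<alpha>" using P0 by (simp add: g_def k_def power_int_minus)
    then show ?case by simp
  next
    case (Suc i)
    have "{k..k + int (Suc i) - 1} = insert (k + int i) {k..k + int i - 1}" by auto
    moreover have "x (k + int i) = D (g i)" by (simp add: x_def)
    moreover have pow: "?P powi (k + int (Suc i)) = ?P powi (k + int i) * ?P"
      using power_int_add_1[of ?P "k + int i"] P0 by (simp add: ac_simps)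
    ultimately have "(\<Sum>j=k..k + int (Suc i) - 1. of_int (x j) * ?P powi j) =
        ?P powi (k + int i) * of_int (D (g i)) + (\<alpha> - ?P powi (k + int i) * g i)"
      using Suc by simp
    also have "?P powi (k + int i) * g i =
        ?P powi (k + int i) * of_int (D (g i)) + ?P powi (k + int (Suc i)) * g (Suc i)"
      unfolding pow by (subst gSuc) (simp add: distrib_left mult.assoc)
    finally show ?case by simp
  qed
  have bound: "padic_abs (\<alpha> - (\<Sum>j=k..int n. of_int (x j) * ?P powi j)) \<le> (1 / real CARD('p)) ^ (n + 1)" for n
  proof -
    \<comment> \<open>The indices from \<open>- int m\<close> to \<open>int n\<close> are
      \<open>n + 1 + m\<close> digits, and the next power of the prime has exponent
      \<open>n + 1\<close>.\<close>
    have "k + int (n + 1 + m) - 1 = int n" "k + int (n + 1 + m) = int (n + 1)" by (simp_all add: k_def)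
    then have "\<alpha> - (\<Sum>j=k..int n. of_int (x j) * ?P powi j) = ?P ^ (n + 1) * g (n + 1 + m)"
      using partial[of "n + 1 + m"] by (simp only: power_int_of_nat) simp
    then have "padic_abs (\<alpha> - (\<Sum>j=k..int n. of_int (x j) * ?P powi j)) =
        (1 / real CARD('p)) ^ (n + 1) * padic_abs (g (n + 1 + m))"
      by (simp only: padic_abs_mult padic_abs_power padic_abs_p)
    also have "\<dots> \<le> (1 / real CARD('p)) ^ (n + 1)"
      using g1[of "n + 1 + m"] by (intro mult_left_le) auto
    finally show ?thesis .
  qed
  have "(\<lambda>n. (1 / real CARD('p)) ^ (n + 1)) \<longlonglongrightarrow> 0"
    using LIMSEQ_ignore_initial_segment[OF LIMSEQ_realpow_zero[of "1 / real CARD('p)"], of 1] p1 by simp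
  then have "(\<lambda>n. padic_abs (\<alpha> - (\<Sum>j=k..int n. of_int (x j) * ?P powi j))) \<longlonglongrightarrow> 0"
    by (rule Lim_null_comparison[rotated])
       (simp only: real_norm_def abs_of_nonneg padic_abs_nonneg bound always_eventually simp_thms)
  moreover have "- (real CARD('p) / 2) < real_of_int (x j) \<and> real_of_int (x j) < real CARD('p) / 2" for j
    using D[OF g1[of "nat (j - k)"]] unfolding x_def abs_less_iff by linarith
  ultimately have "balanced_expansion \<alpha> k x" by (simp add: balanced_expansion_def)
  then show ?thesis by (rule that)
qed

lemma padic_abs_sum_le:
  assumes "B \<ge> 0" "\<And>i. i \<in> A \<Longrightarrow> padic_abs (f i :: 'p::prime_card padic) \<le> B"
  shows "padic_abs (sum f A) \<le> B"
  using assms(2)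
proof (induction A rule: infinite_finite_induct)
  case (insert i A)
  then show ?case using padic_abs_add[of "f i" "sum f A"] by force
qed (use assms(1) padic_abs_eq_0_iff[of "0 :: 'p padic"] in auto)

lemma of_rat_powi: "(of_rat (x powi j) :: 'a::field_char_0) = of_rat x powi j"
  by (simp add: power_int_def of_rat_power of_rat_inverse)

text \<open>Integrality bounds each digit by \<open>(p - 1) / 2\<close>, and such digits give a
  telescoping geometric sum of at most \<open>(p - p powi k) / 2\<close> for
  \<open>k \<le> 0\<close>. The bound \<open>p / 2\<close> for each digit alone would be too
  weak.\<close>

lemma balanced_digit_sum_bound:
  fixes x :: "int \<Rightarrow> int"
  assumes p: "p > 1" and digits: "\<And>j. j \<ge> k \<Longrightarrow> 2 * \<bar>x j\<bar> < int p"
  shows "\<bar>\<Sum>j=k..0. real_of_int (x j) * real p powi j\<bar> < real p / 2"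
proof -
  \<comment> \<open>Here \<open>m\<close> counts the terms: the induction starts from the empty sum
    and adds the new lowest index \<open>- int m\<close>.\<close>
  have *: "\<bar>\<Sum>j=1 - int m..0. real_of_int (x j) * real p powi j\<bar> \<le> (real p - real p powi (1 - int m)) / 2"
    if "k \<le> 1 - int m" for m
    using that
  proof (induction m)
    case (Suc m)
    have "2 * \<bar>x (- int m)\<bar> \<le> int p - 1" using digits[of "- int m"] Suc.prems by linarith
    then have "real_of_int (2 * \<bar>x (- int m)\<bar>) \<le> real_of_int (int p - 1)" by (simp only: of_int_le_iff)
    then have "\<bar>real_of_int (x (- int m))\<bar> \<le> (real p - 1) / 2" by simp
    then have "\<bar>real_of_int (x (- int m)) * real p powi (- int m)\<bar> \<le> (real p - 1) / 2 * real p powi (- int m)"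
      unfolding abs_mult by (intro mult_mono) auto
    also have "\<dots> = (real p powi (1 - int m) - real p powi (- int m)) / 2"
      using p power_int_add[of "real p" 1 "- int m"] by (simp add: left_diff_distrib)
    finally have lead: "\<bar>real_of_int (x (- int m)) * real p powi (- int m)\<bar> \<le>
        (real p powi (1 - int m) - real p powi (- int m)) / 2" .
    have "{1 - int (Suc m)..0} = insert (- int m) {1 - int m..0}" by auto
    then have "(\<Sum>j=1 - int (Suc m)..0. real_of_int (x j) * real p powi j) =
        real_of_int (x (- int m)) * real p powi (- int m) + (\<Sum>j=1 - int m..0. real_of_int (x j) * real p powi j)"
      by simp
    moreover have "\<bar>\<Sum>j=1 - int m..0. real_of_int (x j) * real p powi j\<bar> \<le> (real p - real p powi (1 - int m)) / 2"
      using Suc by simp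
    ultimately have "\<bar>\<Sum>j=1 - int (Suc m)..0. real_of_int (x j) * real p powi j\<bar> \<le>
        (real p powi (1 - int m) - real p powi (- int m)) / 2 + (real p - real p powi (1 - int m)) / 2"
      using lead by (simp only: order_trans[OF abs_triangle_ineq add_mono])
    then show ?case by (simp add: add_divide_distrib diff_divide_distrib)
  qed simp
  show ?thesis
  proof (cases "k \<le> 0")
    case True
    then have "1 - int (nat (1 - k)) = k" by simp
    moreover have "real p powi k > 0" using p by simp
    ultimately show ?thesis using *[of "nat (1 - k)"] by (simp add: diff_divide_distrib)
  qed (use p in simp)
qed

text \<open>Only these three properties of the s-value are used later. The last one holds because
  the terms of positive index have absolute value below 1.\<close>

lemma balanced_expansion_s:
  fixes \<alpha> :: "'p::prime_card padic"
  assumes "balanced_expansion \<alpha> k x"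
  defines "r \<equiv> \<Sum>j=k..0. of_int (x j) * of_nat CARD('p) powi j :: rat"
  shows "r \<in> Z_inv_p CARD('p)" and "real_of_rat \<bar>r\<bar> < real CARD('p) / 2"
    and "padic_abs (\<alpha> - of_rat r) < 1"
proof -
  let ?P = "of_nat CARD('p) :: 'p padic"
  note p1 = CARD_prime_gt_1[where 'p = 'p]
  show "r \<in> Z_inv_p CARD('p)" unfolding r_def
    by (intro Z_inv_p_sum Z_inv_p_mult Z_inv_p_of_int Z_inv_p_powi) simp
  have "2 * \<bar>x j\<bar> < int CARD('p)" if "j \<ge> k" for j
  proof -
    have "2 * \<bar>real_of_int (x j)\<bar> < real CARD('p)"
      using assms(1) that unfolding balanced_expansion_def by auto
    then have "real_of_int (2 * \<bar>x j\<bar>) < real_of_int (int CARD('p))" by simp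
    then show ?thesis by (simp only: of_int_less_iff)
  qed
  moreover have "real_of_rat r = (\<Sum>j=k..0. real_of_int (x j) * real CARD('p) powi j)"
    by (simp add: r_def of_rat_sum of_rat_mult of_rat_powi)
  ultimately have "\<bar>real_of_rat r\<bar> < real CARD('p) / 2"
    using balanced_digit_sum_bound[of "CARD('p)" k x] p1 by simp
  then show "real_of_rat \<bar>r\<bar> < real CARD('p) / 2" by (simp add: abs_if of_rat_minus split: if_splits)
  let ?S = "\<lambda>A. \<Sum>j\<in>A. of_int (x j) * ?P powi j"
  have "\<forall>\<^sub>F n in sequentially. padic_abs (\<alpha> - ?S {k..int n}) < 1"
    using assms(1) unfolding balanced_expansion_def by (auto intro: order_tendstoD)
  then obtain n where n: "padic_abs (\<alpha> - ?S {k..int n}) < 1" by (auto simp: eventually_sequentially)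
  \<comment> \<open>The maximum covers the case \<open>k > 0\<close>, where \<open>r\<close> is the
    empty sum and every term belongs to the tail.\<close>
  have "{k..int n} = {k..0} \<union> {max k 1..int n}" by auto
  then have "?S {k..int n} = of_rat r + ?S {max k 1..int n}"
    by (simp add: sum.union_disjoint r_def of_rat_sum of_rat_mult of_rat_powi)
  moreover have "padic_abs (?S {max k 1..int n}) \<le> 1 / real CARD('p)"
  proof (rule padic_abs_sum_le)
    fix j assume "j \<in> {max k 1..int n}"
    then have "real CARD('p) powi (- j) \<le> real CARD('p) powi (- 1)"
      using p1 by (intro power_int_increasing) auto
    then have "padic_abs (?P powi j) \<le> 1 / real CARD('p)"
      by (simp add: padic_abs_p_powi power_int_minus divide_inverse)
    then show "padic_abs (of_int (x j) * ?P powi j) \<le> 1 / real CARD('p)"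
      using mult_mono[OF padic_abs_of_int_le_1[of "x j", where 'p = 'p], of "padic_abs (?P powi j)"]
      by (simp add: padic_abs_mult padic_abs_nonneg)
  qed simp
  moreover have "1 / real CARD('p) < 1" using p1 by simp
  moreover have "padic_abs (\<alpha> - of_rat r) = padic_abs ((\<alpha> - ?S {k..int n}) + ?S {max k 1..int n})"
    using calculation(1) by simp
  ultimately show "padic_abs (\<alpha> - of_rat r) < 1"
    using n padic_abs_add[of "\<alpha> - ?S {k..int n}" "?S {max k 1..int n}"] by linarith
qed

text \<open>The difference of two candidates is an element of \<open>Z[1/p]\<close> divisible by \<open>p\<close>, of real
  absolute value less than \<open>p\<close>.\<close>

lemma s_value_unique:
  fixes \<alpha> :: "'p::prime_card padic"
  assumes "r \<in> Z_inv_p CARD('p)" "real_of_rat \<bar>r\<bar> < real CARD('p) / 2" "padic_abs (\<alpha> - of_rat r) < 1"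
    and "q \<in> Z_inv_p CARD('p)" "real_of_rat \<bar>q\<bar> < real CARD('p) / 2" "padic_abs (\<alpha> - of_rat q) < 1"
  shows "r = q"
proof (rule ccontr)
  assume "r \<noteq> q"
  have "padic_abs ((\<alpha> - of_rat q) - (\<alpha> - of_rat r)) < 1"
    using padic_abs_diff[of "\<alpha> - of_rat q" "\<alpha> - of_rat r"] assms by linarith
  then have "padic_abs (of_rat (r - q) :: 'p padic) < 1" by (simp add: of_rat_diff)
  then have "rat_padic_abs CARD('p) (r - q) \<le> real CARD('p) powi (- 1)"
    using padic_abs_lt_1_imp_le padic_abs_of_rat[of "r - q", where 'p = 'p]
    by (fastforce simp: power_int_minus divide_inverse)
  moreover have "r - q \<in> Z_inv_p CARD('p)" using assms by (intro Z_inv_p_diff) auto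
  ultimately have "real CARD('p) \<le> real_of_rat \<bar>r - q\<bar>"
    using Z_inv_p_abs_ge[OF prime_card[where 'a = 'p], of "r - q" 1] \<open>r \<noteq> q\<close> by simp
  also have "\<dots> \<le> real_of_rat (\<bar>r\<bar> + \<bar>q\<bar>)" by (simp only: of_rat_less_eq abs_triangle_ineq4)
  finally show False using assms by (simp add: of_rat_add)
qed

text \<open>An existing expansion supplies a value for the definite description, and
  \<open>s_value_unique\<close> shows that all other expansions give the same value. Oddness enters
  through the existence of digits.\<close>

lemma
  fixes \<alpha> :: "'p::prime_card padic"
  assumes "odd CARD('p)"
  shows browkin_s_Z_inv_p: "browkin_s \<alpha> \<in> Z_inv_p CARD('p)"
    and browkin_s_abs: "real_of_rat \<bar>browkin_s \<alpha>\<bar> < real CARD('p) / 2"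
    and browkin_s_approx: "padic_abs (\<alpha> - of_rat (browkin_s \<alpha>)) < 1"
proof -
  obtain k x where kx: "balanced_expansion \<alpha> k x" using balanced_expansion_exists[OF assms] .
  have "browkin_s \<alpha> = (\<Sum>j=k..0. of_int (x j) * of_nat CARD('p) powi j)"
    unfolding browkin_s_def
  proof (rule the_equality)
    show "\<exists>k' x'. balanced_expansion \<alpha> k' x' \<and> (\<Sum>j=k..0. of_int (x j) * of_nat CARD('p) powi j :: rat) =
        (\<Sum>j=k'..0. of_int (x' j) * of_nat CARD('p) powi j)" using kx by blast
  qed (use kx in \<open>auto intro!: s_value_unique[of _ \<alpha>] balanced_expansion_s\<close>)
  then show "browkin_s \<alpha> \<in> Z_inv_p CARD('p)" "real_of_rat \<bar>browkin_s \<alpha>\<bar> < real CARD('p) / 2"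
    "padic_abs (\<alpha> - of_rat (browkin_s \<alpha>)) < 1"
    using balanced_expansion_s[OF kx] by simp_all
qed

subsection \<open>The real root\<close>

text \<open>The polynomial \<open>f\<close> changes sign between 1/2 and 1, where
  \<open>p \<ge> 3\<close> makes \<open>c\<close> and \<open>d\<close> small enough for
  \<open>f 1 > 0\<close>. The bound 1/2 is needed later for the third initial value of the
  recurrence.\<close>

lemma
  assumes "p \<ge> 3"
  shows x_tilde_eq: "x_tilde p ^ 3 = 1 / 2 * x_tilde p ^ 2 + 1 / (2 * real p) * x_tilde p + 1 / real p ^ 3"
    and x_tilde_gt: "x_tilde p > 1 / 2"
    and x_tilde_lt: "x_tilde p < 1"
proof -
  define c where "c = 1 / (2 * real p)"
  define d where "d = 1 / real p ^ 3"
  define f where "f x = x ^ 3 - 1 / 2 * x ^ 2 - c * x - d" for x :: real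
  have cd: "c > 0" "d > 0" using assms by (simp_all add: c_def d_def)
  have c6: "c \<le> 1 / 6" using assms by (simp add: c_def field_simps)
  have "(3 :: real) ^ 3 \<le> real p ^ 3" using assms by (intro power_mono) auto
  then have d27: "d \<le> 1 / 27" unfolding d_def by (intro divide_left_mono) (use assms in auto)
  have f_half: "f (1 / 2) < 0" using cd by (simp add: f_def power3_eq_cube power2_eq_square)
  have f_one: "0 < f 1" using c6 d27 by (simp add: f_def)
  have "\<exists>x\<ge>1 / 2. x \<le> 1 \<and> f x = 0"
  proof (rule IVT')
    show "f (1 / 2) \<le> 0" using f_half by simp
    show "0 \<le> f 1" using f_one by simp
    show "continuous_on {1 / 2..1} f" unfolding f_def by (intro continuous_intros)
  qed simp
  then obtain x where x: "1 / 2 \<le> x" "x \<le> 1" "f x = 0" by blast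
  have no_two: False if "0 < y" "y < z" "f y = 0" "f z = 0" for y z
  proof -
    \<comment> \<open>Eliminating the cubic terms amounts to comparing values of
      \<open>f x / x ^ 3\<close>, which is strictly increasing for positive
      \<open>x\<close>.\<close>
    have "0 = z ^ 3 * f y - y ^ 3 * f z" using that by simp
    also have "\<dots> = - (1 / 2 * (y ^ 2 * z ^ 2) * (z - y) + c * (y * z) * (z ^ 2 - y ^ 2) + d * (z ^ 3 - y ^ 3))"
      by (simp add: f_def field_simps power3_eq_cube power2_eq_square)
    also have "\<dots> < 0"
    proof -
      have "y ^ 2 < z ^ 2" "y ^ 3 < z ^ 3" using that by (auto intro: power_strict_mono)
      then have "1 / 2 * (y ^ 2 * z ^ 2) * (z - y) > 0" "c * (y * z) * (z ^ 2 - y ^ 2) > 0" "d * (z ^ 3 - y ^ 3) > 0"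
        using that cd by (auto intro!: mult_pos_pos)
      then show ?thesis by linarith
    qed
    finally show False by simp
  qed
  have "x_tilde p = x" unfolding x_tilde_def
  proof (rule the_equality)
    show "0 < x \<and> x ^ 3 - 1 / 2 * x ^ 2 - 1 / (2 * real p) * x - 1 / real p ^ 3 = 0"
      using x by (simp add: f_def c_def d_def)
  next
    fix y assume "0 < y \<and> y ^ 3 - 1 / 2 * y ^ 2 - 1 / (2 * real p) * y - 1 / real p ^ 3 = 0"
    then have "0 < y" "f y = 0" by (simp_all add: f_def c_def d_def)
    then show "y = x" using no_two[of x y] no_two[of y x] x by (cases y x rule: linorder_cases) auto
  qed
  moreover have "x \<noteq> 1 / 2" using x f_half by (metis less_irrefl)
  moreover have "x \<noteq> 1" using x f_one by (metis less_irrefl)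
  ultimately show "x_tilde p > 1 / 2" "x_tilde p < 1"
    "x_tilde p ^ 3 = 1 / 2 * x_tilde p ^ 2 + 1 / (2 * real p) * x_tilde p + 1 / real p ^ 3"
    using x by (auto simp: f_def c_def d_def)
qed

text \<open>The sequence \<open>C * r ^ k\<close> solves the recurrence with equality, and
  nonnegative coefficients allow the bounds of the three preceding terms to be inserted.\<close>

lemma cubic_recurrence_bound:
  fixes w :: "nat \<Rightarrow> real"
  assumes r: "r \<ge> 0" "r ^ 3 = A * r ^ 2 + B * r + D" and coeffs: "A \<ge> 0" "B \<ge> 0" "D \<ge> 0"
    and init: "w 0 \<le> C" "w 1 \<le> C * r" "w 2 \<le> C * r ^ 2"
    and rec: "\<And>k. w (k + 3) \<le> A * w (k + 2) + B * w (k + 1) + D * w k"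
  shows "w k \<le> C * r ^ k"
proof (induction k rule: less_induct)
  case (less k)
  show ?case
  proof (cases "k < 3")
    case True
    then have "k = 0 \<or> k = 1 \<or> k = 2" by auto
    then show ?thesis using init by auto
  next
    case False
    then obtain i where k: "k = i + 3" by (metis add.commute le_add_diff_inverse not_less)
    have "w k \<le> A * w (i + 2) + B * w (i + 1) + D * w i" unfolding k by (rule rec)
    also have "\<dots> \<le> A * (C * r ^ (i + 2)) + B * (C * r ^ (i + 1)) + D * (C * r ^ i)"
      using coeffs by (intro add_mono mult_left_mono less) (auto simp: k)
    also have "\<dots> = C * r ^ i * (A * r ^ 2 + B * r + D)"
      by (simp add: algebra_simps power_add power2_eq_square)
    also have "\<dots> = C * r ^ k" unfolding k power_add r(2)[symmetric] by simp
    finally show ?thesis .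
  qed
qed

subsection \<open>The algorithm on homogeneous vectors\<close>

text \<open>The homogeneous form of one step of the algorithm: it maps \<open>(\<alpha>\<^sub>k, \<beta>\<^sub>k, 1)\<close> to a multiple
  of \<open>(\<alpha>\<^sub>k\<^sub>+\<^sub>1, \<beta>\<^sub>k\<^sub>+\<^sub>1, 1)\<close>.\<close>

primrec jp_vec :: "(nat \<Rightarrow> rat) \<Rightarrow> (nat \<Rightarrow> rat) \<Rightarrow> rat \<times> rat \<times> rat \<Rightarrow> nat \<Rightarrow> rat \<times> rat \<times> rat" where
  "jp_vec a b z 0 = z"
| "jp_vec a b z (Suc k) =
     (case jp_vec a b z k of (t, u, v) \<Rightarrow> (v, t - a k * v, u - b k * v))"

lemma jp_vec_Z_inv_p:
  assumes "p > 0" "\<And>k. a k \<in> Z_inv_p p" "\<And>k. b k \<in> Z_inv_p p"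
    and "t \<in> Z_inv_p p" "u \<in> Z_inv_p p" "v \<in> Z_inv_p p"
  shows "jp_vec a b (t, u, v) k \<in> Z_inv_p p \<times> Z_inv_p p \<times> Z_inv_p p"
  by (induction k) (use assms in \<open>auto intro!: Z_inv_p_diff Z_inv_p_mult split: prod.splits\<close>)

text \<open>Substituting \<open>P * x\<close> into
  \<open>X ^ 3 = P / 2 * X ^ 2 + P / 2 * X + 1\<close> and dividing by \<open>P ^ 3\<close> gives
  the equation of \<open>x_tilde\<close>, so \<open>P * x\<close> is the growth rate of the last
  entries.\<close>

lemma jp_vec_bound:
  fixes p :: nat and t u v :: rat
  assumes p: "p \<ge> 3"
    and a: "\<And>k. real_of_rat \<bar>a k\<bar> \<le> real p / 2" and b: "\<And>k. real_of_rat \<bar>b k\<bar> \<le> real p / 2"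
    and M: "real_of_rat \<bar>t\<bar> \<le> M" "real_of_rat \<bar>u\<bar> \<le> M" "real_of_rat \<bar>v\<bar> \<le> M"
  shows "real_of_rat \<bar>snd (snd (jp_vec a b (t, u, v) (n + 1)))\<bar> \<le> 3 * M * real p ^ (n + 1) * x_tilde p ^ n"
proof -
  define x where "x = x_tilde p"
  have x: "x > 1 / 2" "x < 1" "x ^ 3 = 1 / 2 * x ^ 2 + 1 / (2 * real p) * x + 1 / real p ^ 3"
    unfolding x_def using x_tilde_gt[OF p] x_tilde_lt[OF p] x_tilde_eq[OF p] by blast+
  define P where "P = real p"
  have P: "P \<ge> 3" using p by (simp add: P_def)
  define h :: "rat \<Rightarrow> real" where "h q = real_of_rat \<bar>q\<bar>" for q
  have hsub: "h (q - s * q') \<le> h q + P / 2 * h q'" if "h s \<le> P / 2" for q s q'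
  proof -
    have "\<bar>q - s * q'\<bar> \<le> \<bar>q\<bar> + \<bar>s\<bar> * \<bar>q'\<bar>" using abs_triangle_ineq4[of q "s * q'"] by (simp add: abs_mult)
    then have "h (q - s * q') \<le> h q + h s * h q'"
      unfolding h_def by (simp only: of_rat_less_eq flip: of_rat_add of_rat_mult)
    also have "\<dots> \<le> h q + P / 2 * h q'"
      using that by (intro add_left_mono mult_right_mono) (auto simp: h_def)
    finally show ?thesis .
  qed
  define W where "W k = snd (snd (jp_vec a b (t, u, v) k))" for k
  have ah: "h (a k) \<le> P / 2" and bh: "h (b k) \<le> P / 2" for k using a b by (simp_all add: h_def P_def)
  have Mh: "h t \<le> M" "h u \<le> M" "h v \<le> M" using M by (simp_all add: h_def)
  have M0: "M \<ge> 0" using Mh(1) by (auto simp: h_def intro: order_trans[rotated])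
  have rec: "h (W (k + 3)) \<le> P / 2 * h (W (k + 2)) + P / 2 * h (W (k + 1)) + 1 * h (W k)" for k
  proof -
    \<comment> \<open>The first entry is the previous last entry and the second is built from
      earlier ones, so unrolling three steps leaves a recurrence in the last entries alone.\<close>
    have "W (k + 3) = W k - a (k + 1) * W (k + 1) - b (k + 2) * W (k + 2)"
      by (simp add: W_def numeral_3_eq_3 numeral_2_eq_2 split: prod.split)
    then show ?thesis
      using hsub[OF bh[of "k + 2"], of "W k - a (k + 1) * W (k + 1)" "W (k + 2)"]
        hsub[OF ah[of "k + 1"], of "W k" "W (k + 1)"] by simp
  qed
  have W: "W 0 = v" "W 1 = u - b 0 * v" "W 2 = t - a 0 * v - b 1 * W 1"
    by (simp_all add: W_def numeral_2_eq_2)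
  have PM: "P / 2 * h v \<le> P / 2 * M" using Mh P by (intro mult_left_mono) auto
  have W1: "h (W 1) \<le> M + P / 2 * M" using hsub[OF bh[of 0], of u v] Mh PM unfolding W by linarith
  have "P / 2 * h (W 1) \<le> P / 2 * (M + P / 2 * M)" using W1 P by (intro mult_left_mono) auto
  then have W2: "h (W 2) \<le> M + P / 2 * M + P / 2 * (M + P / 2 * M)"
    using hsub[OF bh[of 1], of "t - a 0 * v" "W 1"] hsub[OF ah[of 0], of t v] Mh PM unfolding W(3) by linarith
  \<comment> \<open>Dividing by \<open>x\<close> in the constant turns \<open>x ^ (n + 1)\<close>
    into \<open>x ^ n\<close>. The factor 3 suffices for the three initial values because
    \<open>1 / 2 < x < 1\<close> and \<open>P \<ge> 3\<close>.\<close>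
  have "h (W (n + 1)) \<le> (3 * M / x) * (P * x) ^ (n + 1)"
  proof (rule cubic_recurrence_bound[where A = "P / 2" and B = "P / 2" and D = 1, OF _ _ _ _ _ _ _ _ rec])
    have "(P * x) ^ 3 = P ^ 3 * (1 / 2 * x ^ 2 + 1 / (2 * P) * x + 1 / P ^ 3)"
      using x(3) by (simp add: power_mult_distrib P_def)
    also have "\<dots> = P / 2 * (P * x) ^ 2 + P / 2 * (P * x) + 1"
      using P by (simp add: field_simps power2_eq_square power3_eq_cube)
    finally show "(P * x) ^ 3 = P / 2 * (P * x) ^ 2 + P / 2 * (P * x) + 1" .
    have "M * x \<le> M * 1" using x M0 by (intro mult_left_mono) auto
    then have "M \<le> 3 * M / x" using x M0 by (simp add: field_simps)
    then show "h (W 0) \<le> 3 * M / x" using Mh by (simp add: W)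
    have "M * 3 \<le> M * P" using P M0 by (intro mult_left_mono)
    then have "M + P / 2 * M \<le> 3 * M * P" using M0 by (simp add: algebra_simps)
    then show "h (W 1) \<le> 3 * M / x * (P * x)" using W1 x by simp
    have "3 * P \<le> P * P" using P by (intro mult_right_mono) auto
    then have "1 + P + P\<^sup>2 / 4 \<le> 3 / 2 * P\<^sup>2" using P unfolding power2_eq_square by linarith
    also have "\<dots> \<le> 3 * x * P\<^sup>2" using x by (intro mult_right_mono) auto
    finally have "M * (1 + P + P\<^sup>2 / 4) \<le> M * (3 * x * P\<^sup>2)" using M0 by (intro mult_left_mono)
    moreover have "M * (3 * x * P\<^sup>2) = 3 * M / x * (P * x)\<^sup>2" using x by (simp add: power2_eq_square)
    ultimately show "h (W 2) \<le> 3 * M / x * (P * x)\<^sup>2" using W2 by (simp add: field_simps power2_eq_square)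
  qed (use P x in auto)
  also have "\<dots> = 3 * M * P ^ (n + 1) * x ^ n" using x by (simp add: power_mult_distrib)
  finally show ?thesis by (simp add: h_def W_def P_def x_def)
qed

text \<open>With \<open>E = t - \<alpha> v\<close> and \<open>F = u - \<beta> v\<close>, one step gives \<open>E' = - \<alpha>' F\<close>, \<open>F' = E - \<beta>' F\<close>
  and \<open>v' = F + v / \<alpha>'\<close>, so the errors grow at most by the factor \<open>|\<alpha>'|\<close>, and \<open>|v|\<close> shrinks by
  exactly this factor as long as the error is the smaller term.\<close>

lemma jp_vec_padic_abs:
  fixes X Y :: "nat \<Rightarrow> 'p::prime_card padic" and a b :: "nat \<Rightarrow> rat" and K :: "nat \<Rightarrow> int"
  assumes Y: "\<And>k. k < N \<Longrightarrow> Y k \<noteq> of_rat (b k)"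
    and X_Suc: "\<And>k. k < N \<Longrightarrow> X (Suc k) = 1 / (Y k - of_rat (b k))"
    and Y_Suc: "\<And>k. k < N \<Longrightarrow> Y (Suc k) = (X k - of_rat (a k)) / (Y k - of_rat (b k))"
    and abs_X: "\<And>k. k < N \<Longrightarrow> padic_abs (X (Suc k)) = real CARD('p) powi (K (Suc k) - K k)"
    and abs_Y: "\<And>k. k < N \<Longrightarrow> padic_abs (Y (Suc k)) \<le> padic_abs (X (Suc k))"
    and K0: "K 0 = 0" and K_mono: "\<And>k. k < N \<Longrightarrow> K k < K (Suc k)"
    and v: "v \<noteq> 0"
    and E0: "padic_abs (of_rat t - X 0 * of_rat v) < padic_abs (of_rat v :: 'p padic) * real CARD('p) powi (- 2 * K N)"
    and F0: "padic_abs (of_rat u - Y 0 * of_rat v) < padic_abs (of_rat v :: 'p padic) * real CARD('p) powi (- 2 * K N)"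
  shows "padic_abs (of_rat (snd (snd (jp_vec a b (t, u, v) N))) :: 'p padic) =
    padic_abs (of_rat v :: 'p padic) * real CARD('p) powi (- K N)"
proof -
  let ?p = "real CARD('p)"
  note p1 = CARD_prime_gt_1[where 'p = 'p]
  define T where "T k = (of_rat (fst (jp_vec a b (t, u, v) k)) :: 'p padic)" for k
  define U where "U k = (of_rat (fst (snd (jp_vec a b (t, u, v) k))) :: 'p padic)" for k
  define V where "V k = (of_rat (snd (snd (jp_vec a b (t, u, v) k))) :: 'p padic)" for k
  define E where "E k = T k - X k * V k" for k
  define F where "F k = U k - Y k * V k" for k
  have Suc_vec: "T (Suc k) = V k" "U (Suc k) = T k - of_rat (a k) * V k" "V (Suc k) = U k - of_rat (b k) * V k" for k
    by (simp_all add: T_def U_def V_def of_rat_diff of_rat_mult split: prod.split)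
  have V_Suc: "V (Suc k) = F k + V k / X (Suc k)" if "k < N" for k
    using Y[OF that] by (simp add: Suc_vec F_def X_Suc[OF that] algebra_simps)
  have X_nz: "X (Suc k) \<noteq> 0" if "k < N" for k using Y[OF that] by (simp add: X_Suc[OF that])
  have E_Suc: "E (Suc k) = - (X (Suc k) * F k)" if "k < N" for k
    using X_nz[OF that] by (simp add: E_def Suc_vec(1) V_Suc[OF that] distrib_left)
  have F_Suc: "F (Suc k) = E k - Y (Suc k) * F k" if "k < N" for k
  proof -
    have "Y (Suc k) * (V k / X (Suc k)) = (X k - of_rat (a k)) * V k"
      using Y[OF that] by (simp add: X_Suc[OF that] Y_Suc[OF that])
    then show ?thesis unfolding F_def[of "Suc k"] Suc_vec(2) V_Suc[OF that] E_def by (simp add: algebra_simps)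
  qed
  define B where "B = padic_abs (of_rat v :: 'p padic)"
  have B0: "B > 0" using v padic_abs_eq_0_iff[of "of_rat v :: 'p padic"] padic_abs_nonneg[of "of_rat v :: 'p padic"]
    unfolding B_def by simp
  \<comment> \<open>The growth factors of the first \<open>k\<close> steps multiply to
    \<open>?p powi K k\<close>, since \<open>K 0 = 0\<close>.\<close>
  have EF: "padic_abs (E k) < B * ?p powi (K k - 2 * K N) \<and> padic_abs (F k) < B * ?p powi (K k - 2 * K N)"
    if "k \<le> N" for k
    using that
  proof (induction k)
    case 0
    then show ?case using E0 F0 by (simp add: E_def F_def T_def U_def V_def K0 B_def)
  next
    case (Suc k)
    then have k: "k < N" and IH: "padic_abs (E k) < B * ?p powi (K k - 2 * K N)"
      "padic_abs (F k) < B * ?p powi (K k - 2 * K N)" by simp_all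
    have factor: "?p powi (K (Suc k) - K k) \<ge> 1"
      using K_mono[OF k] p1 by (intro one_le_power_int) auto
    have scale: "B * ?p powi (K (Suc k) - 2 * K N) = ?p powi (K (Suc k) - K k) * (B * ?p powi (K k - 2 * K N))"
      using p1 power_int_add[of ?p "K (Suc k) - K k" "K k - 2 * K N"] by simp
    have XF: "padic_abs (X (Suc k) * F k) < B * ?p powi (K (Suc k) - 2 * K N)"
      unfolding padic_abs_mult abs_X[OF k] scale using IH(2) factor by (intro mult_strict_left_mono) auto
    have "padic_abs (Y (Suc k) * F k) \<le> padic_abs (X (Suc k) * F k)"
      unfolding padic_abs_mult by (intro mult_right_mono abs_Y k padic_abs_nonneg)
    moreover have "1 * (B * ?p powi (K k - 2 * K N)) \<le> B * ?p powi (K (Suc k) - 2 * K N)"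
      unfolding scale using factor B0 by (intro mult_right_mono) auto
    then have "padic_abs (E k) < B * ?p powi (K (Suc k) - 2 * K N)" using IH(1) by linarith
    ultimately show ?case
      using XF padic_abs_diff[of "E k" "Y (Suc k) * F k"]
      unfolding E_Suc[OF k] F_Suc[OF k] padic_abs_minus by linarith
  qed
  have K_le: "K k \<le> K N" if "k \<le> N" for k
    using that
  proof (induction rule: inc_induct)
    case (step m)
    then show ?case using K_mono[of m] by simp
  qed simp
  have "padic_abs (V k) = B * ?p powi (- K k)" if "k \<le> N" for k
    using that
  proof (induction k)
    case 0
    then show ?case by (simp add: V_def B_def K0)
  next
    case (Suc k)
    then have k: "k < N" by simp
    have "?p powi (- K k) / ?p powi (K (Suc k) - K k) = ?p powi (- K (Suc k))"
      using p1 power_int_diff[of ?p "- K k" "K (Suc k) - K k"] by simp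
    then have VX: "padic_abs (V k / X (Suc k)) = B * ?p powi (- K (Suc k))"
      using Suc k by (simp add: padic_abs_divide abs_X flip: times_divide_eq_right)
    have "padic_abs (F k) < B * ?p powi (K k - 2 * K N)" using EF[of k] k by simp
    \<comment> \<open>This is where the factor 2 in the exponent of the hypothesis is spent: both
      \<open>K k\<close> and \<open>K (Suc k)\<close> are at most \<open>K N\<close>.\<close>
    also have "\<dots> \<le> B * ?p powi (- K (Suc k))"
      using B0 p1 K_le[of k] K_le[of "Suc k"] k by (intro mult_left_mono power_int_increasing) auto
    finally show ?case unfolding V_Suc[OF k] VX[symmetric] by (rule padic_abs_add_dominant)
  qed
  then show ?thesis by (simp add: V_def B_def)
qed

section \<open>Comparison of the p-adic and the real bound\<close>

lemma rat_padic_abs_eq_powi_val_inverse: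
  assumes "prime p" "q \<noteq> 0"
  shows "rat_padic_abs p q = real p powi (rat_padic_val p (1 / q))"
proof -
  have "inverse (rat_padic_abs p q) = real p powi (- rat_padic_val p (1 / q))"
    unfolding rat_padic_abs_inverse[OF assms(1), symmetric] using assms(2)
    by (simp add: rat_padic_abs_def inverse_eq_divide)
  then show ?thesis by (simp add: power_int_minus)
qed

theorem theorem15:
  fixes \<alpha> \<beta> :: "'p::prime_card padic" and t u :: rat and v :: int and n :: nat
  assumes "odd CARD('p)"
    and "jp_length_ge \<alpha> \<beta> (n + 1)"
    and "t \<in> Z_inv_p CARD('p)" and "u \<in> Z_inv_p CARD('p)" and "v \<noteq> 0"
    and "max (padic_abs (\<alpha> - of_rat t / of_int v)) (padic_abs (\<beta> - of_rat u / of_int v))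
           < 1 / real CARD('p) powi (2 * jp_K \<alpha> \<beta> (n + 1))"
  shows "Max {real_of_rat \<bar>t\<bar>, real_of_rat \<bar>u\<bar>, real_of_int \<bar>v\<bar>} \<ge> 1 / (3 * x_tilde CARD('p) ^ n)"
proof -
  let ?p = "real CARD('p)" and ?N = "n + 1"
  note p1 = CARD_prime_gt_1[where 'p = 'p]
  have p3: "CARD('p) \<ge> 3"
    using assms(1) prime_gt_1_nat[OF prime_card[where 'a = 'p]] by (cases "CARD('p) = 2") auto
  define X where "X k = fst (the (jp_complete \<alpha> \<beta> k))" for k
  define Y where "Y k = snd (the (jp_complete \<alpha> \<beta> k))" for k
  define a where "a k = browkin_s (X k)" for k
  define b where "b k = browkin_s (Y k)" for k
  define K where "K k = jp_K \<alpha> \<beta> k" for k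
  \<comment> \<open>A stopped algorithm stays stopped, so definedness at \<open>?N\<close>
    propagates downwards.\<close>
  have def: "jp_complete \<alpha> \<beta> k = Some (X k, Y k)" if "k \<le> ?N" for k
  proof -
    have "jp_complete \<alpha> \<beta> k \<noteq> None" using that
    proof (induction rule: inc_induct)
      case base
      show ?case using assms(2) by (simp add: jp_length_ge_def)
    next
      case (step m)
      then show ?case by (cases "jp_complete \<alpha> \<beta> m") simp_all
    qed
    then show ?thesis by (auto simp: X_def Y_def)
  qed
  have step: "Y k \<noteq> of_rat (b k) \<and> X (Suc k) = 1 / (Y k - of_rat (b k)) \<and>
      Y (Suc k) = (X k - of_rat (a k)) / (Y k - of_rat (b k))" if "k < ?N" for k
    using def[of k] def[of "Suc k"] that by (simp add: a_def b_def Let_def split: if_splits)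
  have abs_X: "padic_abs (X (Suc k)) > 1" if "k < ?N" for k
  proof -
    have "0 < padic_abs (Y k - of_rat (b k))"
      using step[OF that] padic_abs_nonneg[of "Y k - of_rat (b k)"] padic_abs_eq_0_iff[of "Y k - of_rat (b k)"]
      by simp
    moreover have "padic_abs (Y k - of_rat (b k)) < 1" unfolding b_def by (rule browkin_s_approx[OF assms(1)])
    ultimately show ?thesis using step[OF that] by (simp add: padic_abs_divide padic_abs_one)
  qed
  \<comment> \<open>Both quotients have the same denominator, and the numerator of
    \<open>Y (Suc k)\<close> is a remainder of absolute value below 1.\<close>
  have abs_Y: "padic_abs (Y (Suc k)) \<le> padic_abs (X (Suc k))" if "k < ?N" for k
    using step[OF that] browkin_s_approx[OF assms(1), of "X k"]
    by (simp add: padic_abs_divide padic_abs_one a_def divide_right_mono padic_abs_nonneg)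
  have K_Suc: "K (Suc k) - K k = jp_k \<alpha> \<beta> (Suc k)" for k by (simp add: K_def jp_K_def)
  \<comment> \<open>Since \<open>X (Suc k)\<close> has absolute value above 1 and its remainder does
    not, its partial quotient has the same absolute value. This can fail at index 0, which
    \<open>jp_K\<close> leaves out.\<close>
  have abs_X_K: "padic_abs (X (Suc k)) = ?p powi (K (Suc k) - K k)" if "k < ?N" for k
  proof -
    have "padic_abs (X (Suc k) - of_rat (a (Suc k))) < padic_abs (X (Suc k))"
      using abs_X[OF that] browkin_s_approx[OF assms(1), of "X (Suc k)"] unfolding a_def by linarith
    then have eq: "rat_padic_abs CARD('p) (a (Suc k)) = padic_abs (X (Suc k))"
      using padic_abs_eq_of_diff_less[of "of_rat (a (Suc k))" "X (Suc k)"] padic_abs_diff_commute[of "X (Suc k)"]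
      by (simp add: padic_abs_of_rat)
    then have "a (Suc k) \<noteq> 0" using abs_X[OF that] by (auto simp: rat_padic_abs_def)
    from rat_padic_abs_eq_powi_val_inverse[OF prime_card[where 'a = 'p] this] eq
    show ?thesis by (simp add: K_Suc jp_k_def jp_a_def a_def X_def)
  qed
  have K_mono: "K k < K (Suc k)" if "k < ?N" for k
  proof (rule ccontr)
    assume "\<not> K k < K (Suc k)"
    then have "?p powi (K (Suc k) - K k) \<le> ?p powi 0" using p1 by (intro power_int_increasing) auto
    then show False using abs_X[OF that] abs_X_K[OF that] by simp
  qed
  have K0: "K 0 = 0" by (simp add: K_def jp_K_def)
  have K_ge: "int k \<le> K k" if "k \<le> ?N" for k
    using that
  proof (induction k)
    case (Suc k)
    then show ?case using K_mono[of k] by simp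
  qed (simp add: K0)
  define w where "w = snd (snd (jp_vec a b (t, u, of_int v) ?N))"
  have v0: "padic_abs (of_int v :: 'p padic) > 0"
    using assms(5) padic_abs_nonneg[of "of_int v :: 'p padic"] padic_abs_eq_0_iff[of "of_int v :: 'p padic"] by simp
  \<comment> \<open>Multiplying by \<open>v\<close> clears the denominator and gives the form
    required by \<open>jp_vec_padic_abs\<close>.\<close>
  have error: "padic_abs (of_rat s - \<xi> * of_int v) < padic_abs (of_int v :: 'p padic) * ?p powi (- 2 * K ?N)"
    if "padic_abs (\<xi> - of_rat s / of_int v) < 1 / ?p powi (2 * K ?N)" for s and \<xi> :: "'p padic"
  proof -
    have "of_rat s - \<xi> * of_int v = - (of_int v * (\<xi> - of_rat s / of_int v))"
      using assms(5) by (simp add: right_diff_distrib mult.commute)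
    then have "padic_abs (of_rat s - \<xi> * of_int v) =
        padic_abs (of_int v :: 'p padic) * padic_abs (\<xi> - of_rat s / of_int v)"
      by (simp only: padic_abs_minus padic_abs_mult)
    also have "\<dots> < padic_abs (of_int v :: 'p padic) * (1 / ?p powi (2 * K ?N))"
      using that v0 by (intro mult_strict_left_mono)
    also have "1 / ?p powi (2 * K ?N) = ?p powi (- 2 * K ?N)"
      by (simp add: power_int_minus divide_inverse)
    finally show ?thesis .
  qed
  have XY0: "X 0 = \<alpha>" "Y 0 = \<beta>" by (simp_all add: X_def Y_def)
  have "padic_abs (of_rat w :: 'p padic) = padic_abs (of_rat (of_int v) :: 'p padic) * ?p powi (- K ?N)"
    unfolding w_def
  proof (rule jp_vec_padic_abs[of ?N Y b X a K])
    show "padic_abs (of_rat t - X 0 * of_rat (of_int v)) < padic_abs (of_rat (of_int v) :: 'p padic) * ?p powi (- 2 * K ?N)"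
      using error[of \<alpha> t] assms(6) by (simp add: XY0 K_def)
    show "padic_abs (of_rat u - Y 0 * of_rat (of_int v)) < padic_abs (of_rat (of_int v) :: 'p padic) * ?p powi (- 2 * K ?N)"
      using error[of \<beta> u] assms(6) by (simp add: XY0 K_def)
  qed (use step abs_X_K abs_Y K0 K_mono assms(5) in simp_all)
  then have w: "rat_padic_abs CARD('p) w = padic_abs (of_int v :: 'p padic) * ?p powi (- K ?N)"
    by (simp add: padic_abs_of_rat)
  have "w \<noteq> 0" using w v0 p1 by (auto simp: rat_padic_abs_def)
  \<comment> \<open>As an integer, \<open>v\<close> has p-adic absolute value at most 1.\<close>
  have "rat_padic_abs CARD('p) w \<le> 1 * ?p powi (- K ?N)"
    unfolding w by (intro mult_right_mono padic_abs_of_int_le_1) simp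
  also have "\<dots> \<le> ?p powi (- int ?N)" using K_ge[of ?N] p1 unfolding mult_1 by (intro power_int_increasing) auto
  finally have "rat_padic_abs CARD('p) w \<le> ?p powi (- int ?N)" .
  moreover have "w \<in> Z_inv_p CARD('p)"
    using jp_vec_Z_inv_p[of "CARD('p)" a b t u "of_int v" ?N] browkin_s_Z_inv_p[OF assms(1)] assms(3,4) Z_inv_p_of_int
    unfolding w_def a_def b_def by (auto simp: mem_Times_iff)
  ultimately have "?p powi int ?N \<le> real_of_rat \<bar>w\<bar>"
    using \<open>w \<noteq> 0\<close> by (intro Z_inv_p_abs_ge prime_card)
  then have lower: "?p ^ ?N \<le> real_of_rat \<bar>w\<bar>" by (simp only: power_int_of_nat)
  define M where "M = Max {real_of_rat \<bar>t\<bar>, real_of_rat \<bar>u\<bar>, real_of_int \<bar>v\<bar>}"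
  have "real_of_rat \<bar>w\<bar> \<le> 3 * M * ?p ^ ?N * x_tilde CARD('p) ^ n"
    unfolding w_def
  proof (rule jp_vec_bound[OF p3])
    \<comment> \<open>This holds also past the end of the expansion, where \<open>X k\<close> and
      \<open>Y k\<close> are unspecified, because \<open>browkin_s_abs\<close> applies to every
      argument.\<close>
    show "real_of_rat \<bar>a k\<bar> \<le> ?p / 2" "real_of_rat \<bar>b k\<bar> \<le> ?p / 2" for k
      unfolding a_def b_def using browkin_s_abs[OF assms(1)] by (auto intro: less_imp_le)
    have "real_of_rat \<bar>of_int v\<bar> = real_of_int \<bar>v\<bar>" by (metis of_int_abs of_rat_of_int_eq)
    then show "real_of_rat \<bar>t\<bar> \<le> M" "real_of_rat \<bar>u\<bar> \<le> M" "real_of_rat \<bar>of_int v\<bar> \<le> M"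
      unfolding M_def by (simp_all only:) (rule Max_ge; simp)+
  qed
  also have "3 * M * ?p ^ ?N * x_tilde CARD('p) ^ n = (3 * M * x_tilde CARD('p) ^ n) * ?p ^ ?N"
    by (simp only: mult_ac)
  finally have "1 * ?p ^ ?N \<le> (3 * M * x_tilde CARD('p) ^ n) * ?p ^ ?N" using lower by linarith
  then have "1 \<le> 3 * M * x_tilde CARD('p) ^ n"
    by (rule mult_right_le_imp_le) (use p1 in simp)
  moreover have "x_tilde CARD('p) ^ n > 0" using x_tilde_gt[OF p3] by (intro zero_less_power) linarith
  ultimately show ?thesis unfolding M_def[symmetric] by (simp add: divide_le_eq mult_ac)
qed

end
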